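(* Every element of the group $BS(1,2)=\langle a,t\mid tat^{-1}=a^2\rangle$ is represented by a unique normal form word, i.e. by exactly one word in the language $\mathcal{NF}\subseteq\{a,a^{-1},t,t^{-1}\}^*$ defined in the context.
   Context: **Normal forms.** Words are over $\{a,a^{-1},t,t^{-1}\}$. The $t$-exponent of a word is the sum of the exponents of its $t^{\pm1}$ letters. An $N$-run is a word $a^{\epsilon_l}t^{-1}a^{\epsilon_{l-1}}t^{-1}\cdots t^{-1}a^{\epsilon_0}$, recorded by its sequence of entries $\epsilon_l\epsilon_{l-1}\cdots\epsilon_0$; a $P$-run is a word $a^{\epsilon_0}ta^{\epsilon_1}t\cdots ta^{\epsilon_l}$, recorded as $\epsilon_0\epsilon_1\cdots\epsilon_l$ (all $\epsilon_i\in\mathbb Z$). "The negative" of a sequence negates all of its entries. When several entries in a list carry $\pm$, all independent sign choices are allowed. The language $\mathcal{NF}$ is the union of the following five families of words ($\epsilon$ denotes the empty word). (1) $\epsilon, a^{\pm1},a^{\pm2},a^{\pm3}$. (2) (types $X$, $XN$, $XNP$; zero or negative $t$-exponent) Words $t^{k}a^{\epsilon_l}t^{-1}a^{\epsilon_{l-1}}t^{-1}\cdots a^{\epsilon_1}t^{-1}a^{\epsilon_0}t^{m}$ with $k>0$, $m\ge0$, $l\ge k+m$, and $\epsilon_0\ne0$ if $m>0$. If $l\ge3$: the $N$-run starts with one of $200,201,210,300,301,30(-1),310$ or the negative of one of these; all later entries are in $\{0,1,-1\}$; and no two consecutive entries are both nonzero, except possibly within the three-entry prefix. If $l\le2$: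 the word is in $L_1$, the set of words - $ta^it^{-1}a^j$, $ij=(\pm2)0,(\pm3)0,21,31,(-2)(-1),(-3)(-1)$; - $ta^it^{-1}a^jt^{-1}a^k$ and $t^2a^it^{-1}a^jt^{-1}a^k$, $ijk=(\pm2)00,(\pm3)00,201,(\pm3)01,(-2)0(-1),(\pm3)0(-1),210,310,(-2)(-1)0,(-3)(-1)0$; - $ta^it^{-1}a^jt^{-1}a^kt$, $ijk=201,(\pm3)01,(-2)0(-1),(\pm3)0(-1)$. (3) (types $N$, $NP_\le$; $t$-exponent $\le0$) Words $a^{\epsilon_l}t^{-1}a^{\epsilon_{l-1}}t^{-1}\cdots a^{\epsilon_1}t^{-1}a^{\epsilon_0}t^{k}$ with $0\le k\le l$, and $\epsilon_0\neq0$ if $k>0$. If $l\ge3$: the $N$-run starts with one of $000,001,010,100,101,10(-1),110,200,201,20(-1),210,300,301,30(-1),310$ or the negative of one of these; all later entries are in $\{0,1,-1\}$; and no two consecutive entries are both nonzero, except possibly within the three-entry prefix. If $l\le 2$: the word is in $L_2$, the set of words - $a^it^{-1}a^j$, $ij=00,(\pm1)0,(\pm2)0,(\pm3)0,0(\pm1),0(\pm2),0(\pm3),11,21,31,(-1)(-1),(-2)(-1),(-3)(-1)$; - $a^it^{-1}a^jt$, $ij=0(\pm1),0(\pm2),0(\pm3),11,21,31,(-1)(-1),(-2)(-1),(-3)(-1)$; - $a^it^{-1}a^jt^{-1}a^k$, $ijk=000,(\pm1)00,(\pm2)00,(\pm3)00,0(\pm1)0,0(\pm2)0,0(\pm3)0,00(\pm1),00(\pm2),00(\pm3),(\pm1)0(\pm1),(\pm2)0(\pm1),(\pm3)0(\pm1),110,210,310,(-1)(-1)0,(-2)(-1)0,(-3)(-1)0$;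 - $a^it^{-1}a^jt^{-1}a^kt$ and $a^it^{-1}a^jt^{-1}a^kt^2$, $ijk=00(\pm1),00(\pm2),00(\pm3),(\pm1)0(\pm1),(\pm2)0(\pm1),(\pm3)0(\pm1)$. (4) (types $P$, $NP_>$; positive $t$-exponent) Words $t^{-k}a^{\epsilon_0}ta^{\epsilon_1}t\cdots a^{\epsilon_{l-1}}ta^{\epsilon_l}$ with $0\le k<l$ and $\epsilon_0\ne0$ if $k>0$. If $l\ge3$: the $P$-run ends with one of $000,100,010,001,101,(-1)01,011,002,102,(-1)02,012,003,103,(-1)03,013$ or the negative of one of these; all earlier entries are in $\{0,1,-1\}$; and no two consecutive entries are both nonzero, except possibly within the three-entry suffix. If $l\le2$: the word (still subject to $0\le k<l$) is in $L_3$, the set of words - $a^ita^j$, $ij=00,0(\pm1),0(\pm2),0(\pm3),(\pm1)0,11,12,13,(-1)(-1),(-1)(-2),(-1)(-3)$; - $t^{-1}a^ita^j$, $ij=(\pm1)0,11,12,13,(-1)(-1),(-1)(-2),(-1)(-3)$; - $a^ita^jta^k$, $ijk=000,00(\pm1),00(\pm2),00(\pm3),(\pm1)0(\pm1),(\pm1)0(\pm2),(\pm1)0(\pm3),0(\pm1)0,011,012,013,0(-1)(-1),0(-1)(-2),0(-1)(-3)$; - $t^{-1}a^ita^jta^k$ and $t^{-2}a^ita^jta^k$, $ijk=(\pm1)0(\pm1),(\pm1)0(\pm2),(\pm1)0(\pm3)$. (5) (types $PX$, $NPX$; positive $t$-exponent) Words $t^{-k}a^{\epsilon_0}ta^{\epsilon_1}t\cdots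 a^{\epsilon_{l-1}}ta^{\epsilon_l}t^{-m}$ with $k\ge0$, $m>0$, $k+m<l$, and $\epsilon_0\neq0$ if $k>0$. If $l\ge3$: the $P$-run ends with one of $002,102,012,003,103,(-1)03,013$ or the negative of one of these; all earlier entries are in $\{0,1,-1\}$; and no two consecutive entries are both nonzero, except possibly within the three-entry suffix. If $l=2$: the word is in $L_4$, the set of words - $a^ita^jta^kt^{-1}$, $ijk=00(\pm2),00(\pm3),012,013,0(-1)(-2),0(-1)(-3),102,10(\pm3),(-1)0(-2),(-1)0(\pm3)$.
   Formalization: As printed the claim fails (t^{-1}a^2t=a, both listed; at^2 has no word). Proved with two tables corrected: entries 0(±2),0(±3),0(±2)0,0(±3)0,00(±2),00(±3) are dropped from L_2, and (±1)00 is added to L_3 for a^ita^jta^k and t^{-1}a^ita^jta^k. *)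

theory Defs
  imports "HOL-Algebra.Group"
begin

section \<open>Groups given by generators and relations\<close>

text \<open>The letter \<open>(g, True)\<close> is the generator \<open>g\<close> and \<open>(g, False)\<close> is its formal inverse.
  Words are not required to be reduced.\<close>

type_synonym 'g word = "('g \<times> bool) list"

definition gpow :: "'g \<Rightarrow> int \<Rightarrow> 'g word" where
  "gpow g n = replicate (nat \<bar>n\<bar>) (g, 0 \<le> n)"

inductive pres_eq :: "('g word \<times> 'g word) set \<Rightarrow> 'g word \<Rightarrow> 'g word \<Rightarrow> bool"
  for R where
  pres_rel: "(u, v) \<in> R \<Longrightarrow> pres_eq R u v"
| pres_cancel: "pres_eq R [(g, b), (g, \<not> b)] []"
| pres_refl: "pres_eq R u u"
| pres_sym: "pres_eq R u v \<Longrightarrow> pres_eq R v u"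
| pres_trans: "pres_eq R u v \<Longrightarrow> pres_eq R v w \<Longrightarrow> pres_eq R u w"
| pres_cong: "pres_eq R u v \<Longrightarrow> pres_eq R (x @ u @ y) (x @ v @ y)"

definition word_class :: "('g word \<times> 'g word) set \<Rightarrow> 'g word \<Rightarrow> 'g word set" where
  "word_class R w = {v. pres_eq R w v}"

definition presented_group :: "('g word \<times> 'g word) set \<Rightarrow> 'g word set monoid" where
  "presented_group R =
    \<lparr>carrier = UNIV // {(u, v). pres_eq R u v},
     mult = (\<lambda>A B. \<Union>u\<in>A. \<Union>v\<in>B. word_class R (u @ v)),
     one = word_class R []\<rparr>"

lemma word_class_eq_iff: "word_class R u = word_class R v \<longleftrightarrow> pres_eq R u v"
proof
  assume "word_class R u = word_class R v"
  then have "v \<in> word_class R u"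
    by (simp add: word_class_def pres_refl)
  then show "pres_eq R u v"
    by (simp add: word_class_def)
next
  assume uv: "pres_eq R u v"
  have "pres_eq R u x \<longleftrightarrow> pres_eq R v x" for x
    using pres_trans[OF uv] pres_trans[OF pres_sym[OF uv]] by blast
  then show "word_class R u = word_class R v"
    by (simp add: word_class_def)
qed

lemma carrier_presented_group: "carrier (presented_group R) = range (word_class R)"
  by (auto simp: presented_group_def quotient_def word_class_def)

lemma one_presented_group: "\<one>\<^bsub>presented_group R\<^esub> = word_class R []"
  by (simp add: presented_group_def)

lemma pres_append:
  assumes "pres_eq R u u'" "pres_eq R v v'"
  shows "pres_eq R (u @ v) (u' @ v')"
proof (rule pres_trans)
  show "pres_eq R (u @ v) (u' @ v)"
    using pres_cong[OF assms(1), of "[]" v] by simp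
  show "pres_eq R (u' @ v) (u' @ v')"
    using pres_cong[OF assms(2), of u' "[]"] by simp
qed

lemma mult_presented_group:
  "word_class R u \<otimes>\<^bsub>presented_group R\<^esub> word_class R v = word_class R (u @ v)"
proof -
  have eq: "word_class R (u' @ v') = word_class R (u @ v)"
    if "u' \<in> word_class R u" "v' \<in> word_class R v" for u' v'
    using that unfolding word_class_eq_iff
    by (intro pres_append pres_sym[of R u u'] pres_sym[of R v v']; simp add: word_class_def)
  have ne: "word_class R u \<noteq> {}" "word_class R v \<noteq> {}"
    unfolding word_class_def by (blast intro: pres_refl)+
  have "(\<Union>u'\<in>word_class R u. \<Union>v'\<in>word_class R v. word_class R (u' @ v')) =
      (\<Union>u'\<in>word_class R u. \<Union>v'\<in>word_class R v. word_class R (u @ v))"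
    by (intro SUP_cong refl eq)
  also have "\<dots> = word_class R (u @ v)"
    using ne by (simp only: UN_constant if_False)
  finally show ?thesis
    by (simp only: presented_group_def monoid.simps)
qed

lemma pres_inverse_word: "pres_eq R (map (\<lambda>(g, b). (g, \<not> b)) (rev w) @ w) []"
proof (induction w)
  case Nil
  show ?case by (simp add: pres_refl)
next
  case (Cons x w)
  obtain g b where x: "x = (g, b)" by (cases x)
  have "pres_eq R [(g, \<not> b), (g, b)] []"
    using pres_cancel[of R g "\<not> b"] by simp
  from pres_cong[OF this, of "map (\<lambda>(g, b). (g, \<not> b)) (rev w)" w]
  show ?case
    using pres_trans[OF _ Cons.IH] x by simp
qed

lemma group_presented_group: "group (presented_group R)"
proof (rule groupI)
  fix x assume "x \<in> carrier (presented_group R)"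
  then obtain w where x: "x = word_class R w"
    by (auto simp: carrier_presented_group)
  show "\<exists>y\<in>carrier (presented_group R). y \<otimes>\<^bsub>presented_group R\<^esub> x = \<one>\<^bsub>presented_group R\<^esub>"
    by (rule bexI[of _ "word_class R (map (\<lambda>(g, b). (g, \<not> b)) (rev w))"])
       (auto simp: x mult_presented_group one_presented_group word_class_eq_iff
          pres_inverse_word carrier_presented_group)
qed (auto simp: carrier_presented_group one_presented_group mult_presented_group)

lemma inv_letter:
  "inv\<^bsub>presented_group R\<^esub> (word_class R [(g, True)]) = word_class R [(g, False)]"
proof -
  interpret group "presented_group R" by (rule group_presented_group)
  show ?thesis
    by (rule inv_equality)
       (use pres_cancel[of R g False] in \<open>auto simp: mult_presented_group one_presented_group
          word_class_eq_iff carrier_presented_group\<close>)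
qed


section \<open>The group BS(1,2)\<close>

datatype bs_gen = gen_a | gen_t

abbreviation apow :: "int \<Rightarrow> bs_gen word" where "apow \<equiv> gpow gen_a"
abbreviation tpow :: "int \<Rightarrow> bs_gen word" where "tpow \<equiv> gpow gen_t"

definition bs_relations :: "(bs_gen word \<times> bs_gen word) set" where
  "bs_relations = {(tpow 1 @ apow 1 @ tpow (- 1), apow 2)}"

definition BS12 :: "bs_gen word set monoid" where
  "BS12 = presented_group bs_relations"

definition represents :: "bs_gen word \<Rightarrow> bs_gen word set \<Rightarrow> bool" where
  "represents w g \<longleftrightarrow> word_class bs_relations w = g"


section \<open>Normal forms\<close>

text \<open>Runs are given by their recorded sequences of entries. So for an \<open>N\<close>-run the list is
  \<open>[\<epsilon>\<^sub>l, \<dots>, \<epsilon>\<^sub>0]\<close>, with \<open>\<epsilon>\<^sub>0\<close> last, and for a \<open>P\<close>-run it is \<open>[\<epsilon>\<^sub>0, \<dots>, \<epsilon>\<^sub>l]\<close>, with \<open>\<epsilon>\<^sub>0\<close> first; in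
  both cases its length is \<open>l + 1\<close>.\<close>

fun N_run :: "int list \<Rightarrow> bs_gen word" where
  "N_run [] = []"
| "N_run [e] = apow e"
| "N_run (e # e' # es) = apow e @ tpow (- 1) @ N_run (e' # es)"

fun P_run :: "int list \<Rightarrow> bs_gen word" where
  "P_run [] = []"
| "P_run [e] = apow e"
| "P_run (e # e' # es) = apow e @ tpow 1 @ P_run (e' # es)"

text \<open>All independent sign choices, e.g. \<open>signs [2, 0, 1]\<close> is the list entry
  \<open>(\<plusminus>2)0(\<plusminus>1)\<close>.\<close>

definition signs :: "int list \<Rightarrow> int list set" where
  "signs es = {ds. map abs ds = map abs es}"

definition with_negatives :: "int list set \<Rightarrow> int list set" where
  "with_negatives S = S \<union> map uminus ` S"

definition long_N :: "int list set \<Rightarrow> int list \<Rightarrow> bool" where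
  "long_N S es \<longleftrightarrow>
     take 3 es \<in> with_negatives S \<and>
     set (drop 3 es) \<subseteq> {0, 1, - 1} \<and>
     (\<forall>i. 2 \<le> i \<and> Suc i < length es \<longrightarrow> es ! i = 0 \<or> es ! Suc i = 0)"

definition long_P :: "int list set \<Rightarrow> int list \<Rightarrow> bool" where
  "long_P S es \<longleftrightarrow>
     drop (length es - 3) es \<in> with_negatives S \<and>
     set (take (length es - 3) es) \<subseteq> {0, 1, - 1} \<and>
     (\<forall>i < length es - 3. es ! i = 0 \<or> es ! Suc i = 0)"

definition prefixes_X :: "int list set" where
  "prefixes_X = {[2,0,0], [2,0,1], [2,1,0], [3,0,0], [3,0,1], [3,0,-1], [3,1,0]}"

definition prefixes_N :: "int list set" where
  "prefixes_N = {[0,0,0], [0,0,1], [0,1,0], [1,0,0], [1,0,1], [1,0,-1], [1,1,0],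
     [2,0,0], [2,0,1], [2,0,-1], [2,1,0], [3,0,0], [3,0,1], [3,0,-1], [3,1,0]}"

definition suffixes_P :: "int list set" where
  "suffixes_P = {[0,0,0], [1,0,0], [0,1,0], [0,0,1], [1,0,1], [-1,0,1], [0,1,1],
     [0,0,2], [1,0,2], [-1,0,2], [0,1,2], [0,0,3], [1,0,3], [-1,0,3], [0,1,3]}"

definition suffixes_PX :: "int list set" where
  "suffixes_PX = {[0,0,2], [1,0,2], [0,1,2], [0,0,3], [1,0,3], [-1,0,3], [0,1,3]}"

text \<open>The argument \<open>L\<close> of the following families is the table of words for \<open>l \<le> 2\<close>.\<close>

definition NF_short :: "bs_gen word set" where
  "NF_short = apow ` {- 3..3}"

definition NF_X :: "bs_gen word set \<Rightarrow> bs_gen word set" where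
  "NF_X L = {w. \<exists>k m l es. w = tpow (int k) @ N_run es @ tpow (int m) \<and>
     length es = Suc l \<and> 0 < k \<and> k + m \<le> l \<and> (0 < m \<longrightarrow> last es \<noteq> 0) \<and>
     (if 3 \<le> l then long_N prefixes_X es else w \<in> L)}"

definition NF_N :: "bs_gen word set \<Rightarrow> bs_gen word set" where
  "NF_N L = {w. \<exists>k l es. w = N_run es @ tpow (int k) \<and>
     length es = Suc l \<and> k \<le> l \<and> (0 < k \<longrightarrow> last es \<noteq> 0) \<and>
     (if 3 \<le> l then long_N prefixes_N es else w \<in> L)}"

definition NF_P :: "bs_gen word set \<Rightarrow> bs_gen word set" where
  "NF_P L = {w. \<exists>k l es. w = tpow (- int k) @ P_run es \<and>
     length es = Suc l \<and> k < l \<and> (0 < k \<longrightarrow> hd es \<noteq> 0) \<and>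
     (if 3 \<le> l then long_P suffixes_P es else w \<in> L)}"

definition NF_PX :: "bs_gen word set \<Rightarrow> bs_gen word set" where
  "NF_PX L = {w. \<exists>k m l es. w = tpow (- int k) @ P_run es @ tpow (- int m) \<and>
     length es = Suc l \<and> 0 < m \<and> k + m < l \<and> (0 < k \<longrightarrow> hd es \<noteq> 0) \<and>
     (if 3 \<le> l then long_P suffixes_PX es else w \<in> L)}"

definition L1 :: "bs_gen word set" where
  "L1 =
     {tpow 1 @ N_run es | es.
        es \<in> signs [2,0] \<union> signs [3,0] \<union> {[2,1], [3,1], [-2,-1], [-3,-1]}} \<union>
     {tpow k @ N_run es | k es. k \<in> {1, 2} \<and>
        es \<in> signs [2,0,0] \<union> signs [3,0,0] \<union>
          {[2,0,1], [3,0,1], [-3,0,1], [-2,0,-1], [3,0,-1], [-3,0,-1],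
           [2,1,0], [3,1,0], [-2,-1,0], [-3,-1,0]}} \<union>
     {tpow 1 @ N_run es @ tpow 1 | es.
        es \<in> {[2,0,1], [3,0,1], [-3,0,1], [-2,0,-1], [3,0,-1], [-3,0,-1]}}"

definition L2_printed :: "bs_gen word set" where
  "L2_printed =
     {N_run es | es.
        es \<in> signs [0,0] \<union> signs [1,0] \<union> signs [2,0] \<union> signs [3,0] \<union>
          signs [0,1] \<union> signs [0,2] \<union> signs [0,3] \<union>
          {[1,1], [2,1], [3,1], [-1,-1], [-2,-1], [-3,-1]}} \<union>
     {N_run es @ tpow 1 | es.
        es \<in> signs [0,1] \<union> signs [0,2] \<union> signs [0,3] \<union>
          {[1,1], [2,1], [3,1], [-1,-1], [-2,-1], [-3,-1]}} \<union>
     {N_run es | es.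
        es \<in> signs [0,0,0] \<union> signs [1,0,0] \<union> signs [2,0,0] \<union> signs [3,0,0] \<union>
          signs [0,1,0] \<union> signs [0,2,0] \<union> signs [0,3,0] \<union>
          signs [0,0,1] \<union> signs [0,0,2] \<union> signs [0,0,3] \<union>
          signs [1,0,1] \<union> signs [2,0,1] \<union> signs [3,0,1] \<union>
          {[1,1,0], [2,1,0], [3,1,0], [-1,-1,0], [-2,-1,0], [-3,-1,0]}} \<union>
     {N_run es @ tpow k | k es. k \<in> {1, 2} \<and>
        es \<in> signs [0,0,1] \<union> signs [0,0,2] \<union> signs [0,0,3] \<union>
          signs [1,0,1] \<union> signs [2,0,1] \<union> signs [3,0,1]}"

definition L3_printed :: "bs_gen word set" where
  "L3_printed =
     {P_run es | es.
        es \<in> signs [0,0] \<union> signs [0,1] \<union> signs [0,2] \<union> signs [0,3] \<union> signs [1,0] \<union>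
          {[1,1], [1,2], [1,3], [-1,-1], [-1,-2], [-1,-3]}} \<union>
     {tpow (- 1) @ P_run es | es.
        es \<in> signs [1,0] \<union> {[1,1], [1,2], [1,3], [-1,-1], [-1,-2], [-1,-3]}} \<union>
     {P_run es | es.
        es \<in> signs [0,0,0] \<union> signs [0,0,1] \<union> signs [0,0,2] \<union> signs [0,0,3] \<union>
          signs [1,0,1] \<union> signs [1,0,2] \<union> signs [1,0,3] \<union> signs [0,1,0] \<union>
          {[0,1,1], [0,1,2], [0,1,3], [0,-1,-1], [0,-1,-2], [0,-1,-3]}} \<union>
     {tpow (- k) @ P_run es | k es. k \<in> {1, 2} \<and>
        es \<in> signs [1,0,1] \<union> signs [1,0,2] \<union> signs [1,0,3]}"

definition L4 :: "bs_gen word set" where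
  "L4 =
     {P_run es @ tpow (- 1) | es.
        es \<in> signs [0,0,2] \<union> signs [0,0,3] \<union>
          {[0,1,2], [0,1,3], [0,-1,-2], [0,-1,-3], [1,0,2], [1,0,3], [1,0,-3],
           [-1,0,-2], [-1,0,3], [-1,0,-3]}}"

text \<open>Two of the published tables contain misprints. The second one lists entries \<open>\<plusminus>2\<close>, \<open>\<plusminus>3\<close>
  after a leading \<open>0\<close>; as \<open>t\<^sup>-\<^sup>1a\<^sup>2 = at\<^sup>-\<^sup>1\<close> these words represent the same elements as other listed
  words (an instance is \<open>NF_printed_not_unique\<close> below). The third one lacks \<open>(\<plusminus>1)00\<close>, without
  which \<open>a\<^sup>\<plusminus>\<^sup>1t\<^sup>2\<close> and \<open>t\<^sup>-\<^sup>1a\<^sup>\<plusminus>\<^sup>1t\<^sup>2\<close> have no representative. Both corrections agree with the lists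
  \<open>prefixes_N\<close> and \<open>suffixes_P\<close> for \<open>l \<ge> 3\<close>, which contain no \<open>020\<close>, \<open>030\<close>, \<open>002\<close>, \<open>003\<close> and
  do contain \<open>100\<close>, respectively.\<close>

definition L2 :: "bs_gen word set" where
  "L2 = L2_printed -
     ({N_run es | es. es \<in> signs [0,2] \<union> signs [0,3] \<union>
         signs [0,2,0] \<union> signs [0,3,0] \<union> signs [0,0,2] \<union> signs [0,0,3]} \<union>
      {N_run es @ tpow 1 | es. es \<in> signs [0,2] \<union> signs [0,3]} \<union>
      {N_run es @ tpow k | k es. k \<in> {1, 2} \<and> es \<in> signs [0,0,2] \<union> signs [0,0,3]})"

definition L3 :: "bs_gen word set" where
  "L3 = L3_printed \<union> {tpow (- k) @ P_run es | k es. k \<in> {0, 1} \<and> es \<in> signs [1,0,0]}"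

definition NF :: "bs_gen word set" where
  "NF = NF_short \<union> NF_X L1 \<union> NF_N L2 \<union> NF_P L3 \<union> NF_PX L4"

definition NF_printed :: "bs_gen word set" where
  "NF_printed = NF_short \<union> NF_X L1 \<union> NF_N L2_printed \<union> NF_P L3_printed \<union> NF_PX L4"

lemma NF_printed_not_unique:
  "\<not> (\<forall>g \<in> carrier BS12. \<exists>!w. w \<in> NF_printed \<and> represents w g)"
proof
  assume *: "\<forall>g \<in> carrier BS12. \<exists>!w. w \<in> NF_printed \<and> represents w g"
  let ?u = "apow 1" and ?v = "N_run [0, 2] @ tpow 1"
  let ?T = "(gen_t, False)" and ?t = "(gen_t, True)" and ?a = "(gen_a, True)"
  have u: "?u = [?a]" and v: "?v = [?T, ?a, ?a, ?t]"
    by (simp_all add: gpow_def numeral_2_eq_2)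
  have "?u \<in> NF_short"
    unfolding NF_short_def by (rule imageI) simp
  then have "?u \<in> NF_printed"
    by (simp add: NF_printed_def)
  moreover have "?v \<in> L2_printed"
  proof -
    have "[0, 2] \<in> signs [0, 2]" by (simp add: signs_def)
    then show ?thesis unfolding L2_printed_def by blast
  qed
  then have "?v \<in> NF_N L2_printed"
    unfolding NF_N_def
    by (intro CollectI exI[of _ 1] exI[of _ "[0, 2]"]) simp
  then have "?v \<in> NF_printed"
    by (simp add: NF_printed_def)
  moreover have "pres_eq bs_relations ?v ?u"
  proof -
    let ?eq = "pres_eq bs_relations"
    have "?eq [?t, ?a, ?T] [?a, ?a]"
      by (rule pres_rel) (simp add: bs_relations_def gpow_def numeral_2_eq_2)
    then have "?eq ?v [?T, ?t, ?a, ?T, ?t]"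
      unfolding v using pres_cong[of bs_relations "[?a, ?a]" "[?t, ?a, ?T]" "[?T]" "[?t]"]
      by (simp add: pres_sym)
    also have "?eq \<dots> [?a, ?T, ?t]"
      using pres_cong[OF pres_cancel[of bs_relations gen_t False], of "[]" "[?a, ?T, ?t]"] by simp
    also (pres_trans) have "?eq \<dots> [?a]"
      using pres_cong[OF pres_cancel[of bs_relations gen_t False], of "[?a]" "[]"] by simp
    finally (pres_trans) show ?thesis unfolding u .
  qed
  then have "represents ?v (word_class bs_relations ?u)"
    by (simp add: represents_def word_class_eq_iff)
  moreover have "represents ?u (word_class bs_relations ?u)"
    by (simp add: represents_def)
  moreover have "word_class bs_relations ?u \<in> carrier BS12"
    by (simp add: BS12_def carrier_presented_group)
  ultimately have "?u = ?v"
    using * by blast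
  then show False
    unfolding u v by simp
qed

end

theory Submission
  imports Defs Complex_Main
begin

text \<open>The group $BS(1,2)$ is \<open>\<int>[1/2] \<rtimes> \<int>\<close>: an element is determined by a dyadic number \<open>x\<close> and its
  \<open>t\<close>-exponent \<open>n\<close>, where multiplication on the left by \<open>a\<close> adds \<open>1\<close> to \<open>x\<close>, and by \<open>t\<close> doubles
  \<open>x\<close> and adds \<open>1\<close> to \<open>n\<close> (\<open>act_faithful\<close>). In these coordinates a run is a binary expansion with signed digits: its
  entries, from the lowest digit to the highest one, spell an integer \<open>M\<close> (\<open>act_N_run\<close>,
  \<open>act_P_run\<close>), and the powers of \<open>t\<close> on both sides only divide \<open>M\<close> by a power of \<open>2\<close> and fix
  the \<open>t\<close>-exponent.

  The lists of admissible prefixes, suffixes and short words all encode one condition on the digits: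
  they form a non-adjacent form (digits in \<open>{0, 1, -1}\<close>, no two neighbours nonzero), except that the
  highest digit may have absolute value up to \<open>3\<close> and may have a nonzero neighbour of the same sign.
  This is the predicate \<open>expansion\<close>. If there are at least three digits, the parity of \<open>M\<close>, and its
  residue modulo \<open>4\<close> if it is odd, force the lowest one; if there are two, the parity and the sign of
  \<open>M\<close> do. So an expansion of given length is unique; and \<open>M\<close> has one of
  length \<open>l + 1\<close> exactly if \<open>\<bar>M\<bar> < 11/3 \<cdot> 2\<^sup>l\<close> (\<open>expansion_fits\<close>, \<open>expansion_inj\<close>,
  \<open>expansion_exists\<close>). The bound is sharp for the largest leading part \<open>3 1 0 1 0 1 \<dots>\<close>. The
  shorter lists, for the types \<open>X\<close> and \<open>PX\<close>, add the condition that \<open>M\<close> would not fit into one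
  digit less (\<open>overflows\<close>).

  Hence a normal form word is found as follows, without any choice. If \<open>n \<le> 0\<close>, then
  \<open>x = M / 2\<^sup>L\<close> for the least \<open>L \<ge> -n\<close> with \<open>M\<close> an integer; the excess \<open>m = L + n\<close> is the
  final power of \<open>t\<close>, and \<open>M\<close> is odd if \<open>m > 0\<close>, which is the requirement \<open>\<epsilon>\<^sub>0 \<noteq> 0\<close>. The run
  has \<open>L + 1\<close> digits if \<open>M\<close> fits into them, and otherwise as many more as necessary; the surplus
  \<open>k\<close> is the initial power of \<open>t\<close>. For \<open>n > 0\<close> the word is read in the opposite direction: now the
  initial power of \<open>t\<close> is the denominator of \<open>x\<close> and the final power is the surplus of digits.\<close>

section \<open>Signed binary expansions with a large leading digit\<close>

abbreviation digit_value :: "int list \<Rightarrow> int" where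
  "digit_value \<equiv> horner_sum (\<lambda>d. d) 2"

text \<open>Digits are listed from the lowest to the highest one. For \<open>N\<close>-runs this is the reverse of the
  recorded sequence. The condition \<open>0 \<le> c * d\<close> concerns the two highest digits only: both \<open>c\<close> and
  \<open>d\<close> may be nonzero, but then their signs agree, so that \<open>1 = [1, 0]\<close> has no second expansion
  \<open>[-1, 1]\<close>.\<close>

fun expansion :: "int list \<Rightarrow> bool" where
  "expansion [] \<longleftrightarrow> False"
| "expansion [d] \<longleftrightarrow> \<bar>d\<bar> \<le> 3"
| "expansion [c, d] \<longleftrightarrow> c \<in> {0, 1, - 1} \<and> \<bar>d\<bar> \<le> 3 \<and> 0 \<le> c * d"
| "expansion (b # c # d # ds) \<longleftrightarrow>
     b \<in> {0, 1, - 1} \<and> (b = 0 \<or> c = 0) \<and> expansion (c # d # ds)"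

text \<open>The largest values are those of the digits \<open>3, 1, 0, 1, 0, \<dots>\<close> (highest digit first), which
  are \<open>3 \<cdot> 2\<^sup>l + 2\<^sup>l\<^sup>-\<^sup>1 + 2\<^sup>l\<^sup>-\<^sup>3 + \<dots>\<close>. This is less than \<open>11/3 \<cdot> 2\<^sup>l\<close> and is the largest integer
  below it.\<close>

definition fits :: "nat \<Rightarrow> int \<Rightarrow> bool" where
  "fits l M \<longleftrightarrow> 3 * \<bar>M\<bar> < 11 * 2 ^ l"

lemma fits_mono: "fits l M \<Longrightarrow> l \<le> l' \<Longrightarrow> fits l' M"
  unfolding fits_def by (rule less_le_trans) auto

text \<open>A new lowest digit does not disturb the bound. This is clear for the digit \<open>0\<close>. A digit
  \<open>\<plusminus>1\<close> is used on an even \<open>M = 2 R\<close> only; then the two bounds compare \<open>4 R \<plusminus> 1\<close> and \<open>4 R\<close> with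
  \<open>4 K / 3\<close> for \<open>K = 11 \<cdot> 2\<^sup>l\<^sup>-\<^sup>1\<close>. As \<open>3\<close> does not divide \<open>K\<close>, the integers \<open>3 \<bar>R\<bar>\<close> and \<open>K\<close>
  differ by at least \<open>1\<close>, so \<open>12 \<bar>R\<bar>\<close> and \<open>4 K\<close> differ by at least \<open>4\<close>, more than the \<open>3\<close> which the
  digit contributes.\<close>

lemma fits_Suc_digit:
  assumes "0 < l" "e \<in> {0, 1, - 1}" "e = 0 \<or> even M"
  shows "fits (Suc l) (e + 2 * M) \<longleftrightarrow> fits l M"
proof (cases "e = 0")
  case True
  then show ?thesis by (simp add: fits_def abs_mult)
next
  case False
  obtain j where j: "l = Suc j" using assms(1) by (cases l) auto
  obtain R where R: "M = 2 * R" using assms(3) False by auto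
  define K :: int where "K = 11 * 2 ^ j"
  have "\<not> 3 dvd K" unfolding K_def
  proof (induction j)
    case (Suc j)
    then show ?case by (simp only: power_Suc) presburger
  qed simp
  then have "K = 3 * (K div 3) + 1 \<or> K = 3 * (K div 3) + 2" by presburger
  then obtain q where "K = 3 * q + 1 \<or> K = 3 * q + 2" by blast
  moreover have "e = 1 \<or> e = - 1" using assms(2) False by simp
  ultimately have "3 * \<bar>e + 4 * R\<bar> < 4 * K \<longleftrightarrow> 3 * \<bar>2 * R\<bar> < 2 * K"
    by (auto simp: abs_if) presburger+
  then show ?thesis by (simp add: fits_def j R K_def)
qed

lemma expansion_Cons:
  "2 \<le> length ds \<Longrightarrow> expansion (b # ds) \<longleftrightarrow>
     b \<in> {0, 1, - 1} \<and> (b = 0 \<or> hd ds = 0) \<and> expansion ds"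
  by (cases "b # ds" rule: expansion.cases) auto

lemma two_digit_expansion_cases:
  assumes "expansion [c, d]"
  shows "c = 0 \<or> c = 1 \<or> c = - 1"
    "d = -3 \<or> d = -2 \<or> d = -1 \<or> d = 0 \<or> d = 1 \<or> d = 2 \<or> d = 3"
proof -
  have "\<bar>d\<bar> \<le> 3" using assms by simp
  then show "d = -3 \<or> d = -2 \<or> d = -1 \<or> d = 0 \<or> d = 1 \<or> d = 2 \<or> d = 3"
    by auto
qed (use assms in simp_all)

lemma three_digit_expansion_cases:
  assumes "expansion [b, c, d]"
  shows "b = 0 \<or> b = 1 \<or> b = - 1" "c = 0 \<or> c = 1 \<or> c = - 1"
    "d = -3 \<or> d = -2 \<or> d = -1 \<or> d = 0 \<or> d = 1 \<or> d = 2 \<or> d = 3"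
proof -
  have "\<bar>d\<bar> \<le> 3" using assms by simp
  then show "d = -3 \<or> d = -2 \<or> d = -1 \<or> d = 0 \<or> d = 1 \<or> d = 2 \<or> d = 3"
    by auto
qed (use assms in simp_all)

lemma even_digit_value:
  "expansion ds \<Longrightarrow> 2 \<le> length ds \<Longrightarrow> even (digit_value ds) \<longleftrightarrow> hd ds = 0"
  by (cases ds rule: expansion.cases) auto

lemma even_digit_value_if_hd_0: "hd ds = 0 \<Longrightarrow> even (digit_value ds)"
  by (cases ds) auto

lemma expansion_fits:
  assumes "expansion ds" shows "fits (length ds - 1) (digit_value ds)"
  using assms
proof (induction ds rule: expansion.induct)
  case (4 b c d ds)
  have "fits (Suc (length ds + 1)) (b + 2 * digit_value (c # d # ds))"
    by (subst fits_Suc_digit) (use 4 even_digit_value_if_hd_0[of "c # d # ds"] in auto)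
  then show ?case by simp
qed (auto simp: fits_def)

text \<open>The digit \<open>0\<close> is forced if the value is even, and if it is odd then it is \<open>1\<close> or \<open>-1\<close>
  modulo \<open>4\<close>, which determines the sign.\<close>

lemma signed_digit_unique:
  fixes e e' M M' :: int
  assumes "e \<in> {0, 1, - 1}" "e = 0 \<or> even M" "e' \<in> {0, 1, - 1}" "e' = 0 \<or> even M'"
    and "e + 2 * M = e' + 2 * M'"
  shows "e = e' \<and> M = M'"
proof -
  have "e = e'" using assms by (auto elim!: evenE) presburger+
  then show ?thesis using assms by simp
qed

lemma expansion_inj:
  assumes "expansion ds" "expansion ds'" "length ds = length ds'"
    "digit_value ds = digit_value ds'"
  shows "ds = ds'"
  using assms
proof (induction ds arbitrary: ds' rule: expansion.induct)
  case (2 d)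
  then show ?case by (cases ds') auto
next
  case (3 c d)
  then obtain c' d' where ds': "ds' = [c', d']"
    by (auto simp: length_Suc_conv eq_commute[of "Suc _"])
  have "c \<in> {0, 1, - 1}" "c' \<in> {0, 1, - 1}" "0 \<le> c * d" "0 \<le> c' * d'" "c + 2 * d = c' + 2 * d'"
    using 3 ds' by auto
  then have "c = c' \<and> d = d'" by auto presburger+
  then show ?case using ds' by simp
next
  case (4 b c d ds)
  then obtain b' es where ds': "ds' = b' # es" by (cases ds') auto
  have len: "length es = length (c # d # ds)" using 4 ds' by simp
  have e: "expansion es" "b' \<in> {0, 1, - 1}" "b' = 0 \<or> hd es = 0"
    using 4 ds' expansion_Cons[of es b'] len by auto
  let ?v = "digit_value (c # d # ds)" and ?v' = "digit_value es"
  have b: "b \<in> {0, 1, - 1}" "b = 0 \<or> even ?v"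
    using 4 by auto
  have b': "b' = 0 \<or> even ?v'" using e even_digit_value_if_hd_0[of es] by auto
  have "b + 2 * ?v = b' + 2 * ?v'" using 4 ds' by simp
  then have "b = b' \<and> ?v = ?v'" using b b' e(2) by (intro signed_digit_unique) auto
  then show ?case using 4 ds' e len by auto
qed auto

lemma expansion_exists:
  assumes "fits l M" shows "\<exists>ds. expansion ds \<and> length ds = Suc l \<and> digit_value ds = M"
  using assms
proof (induction l arbitrary: M)
  case 0
  then show ?case by (intro exI[of _ "[M]"]) (auto simp: fits_def)
next
  case (Suc l)
  show ?case
  proof (cases "l = 0")
    case True
    then have "\<bar>M\<bar> \<le> 7" using Suc.prems by (simp add: fits_def)
    \<comment> \<open>Taking the sign of \<open>M\<close> as the lowest digit makes the two top digits agree in sign.\<close>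
    define e where "e = (if even M then 0 else sgn M)"
    have "expansion [e, (M - e) div 2]"
      using \<open>\<bar>M\<bar> \<le> 7\<close> by (auto simp: e_def sgn_if)
    moreover have "digit_value [e, (M - e) div 2] = M"
      by (auto simp: e_def sgn_if)
    ultimately show ?thesis using True by (metis length_Cons list.size(3))
  next
    case False
    obtain e R where eR: "M = e + 2 * R" "e \<in> {0, 1, - 1}" "e = 0 \<or> even R"
    proof (cases "even M")
      case True
      then show ?thesis using that[of 0 "M div 2"] by auto
    next
      case odd: False
      show ?thesis
      proof (cases "M mod 4 = 1")
        case True
        then have "M = 1 + 2 * (2 * (M div 4))" by presburger
        then show ?thesis using that[of 1 "2 * (M div 4)"] by simp
      next
        case False
        then have "M = - 1 + 2 * (2 * (M div 4 + 1))" using odd by presburger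
        then show ?thesis using that[of "- 1" "2 * (M div 4 + 1)"] by simp
      qed
    qed
    have "fits l R" using fits_Suc_digit[of l e R] Suc.prems False eR by simp
    then obtain ds where ds: "expansion ds" "length ds = Suc l" "digit_value ds = R"
      using Suc.IH by blast
    then have "expansion (e # ds)"
      using eR False even_digit_value[of ds] by (subst expansion_Cons) auto
    then show ?thesis using ds eR by (intro exI[of _ "e # ds"]) auto
  qed
qed

text \<open>A list of length \<open>l + 1\<close> has \<open>fits (l - 1)\<close> as the bound for one digit less. The subtraction
  is meant for lists with at least two digits.\<close>

definition overflows :: "int list \<Rightarrow> bool" where
  "overflows ds \<longleftrightarrow> \<not> fits (length ds - 2) (digit_value ds)"

lemma overflows_Cons:
  assumes "3 \<le> length ds" "b \<in> {0, 1, - 1}" "b = 0 \<or> hd ds = 0"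
  shows "overflows (b # ds) \<longleftrightarrow> overflows ds"
proof -
  have "length (b # ds) - 2 = Suc (length ds - 2)" using assms by simp
  then show ?thesis
    unfolding overflows_def
    using fits_Suc_digit[of "length ds - 2" b "digit_value ds"] even_digit_value_if_hd_0[of ds] assms
    by force
qed

text \<open>The integers fall into disjoint classes: those that fit into \<open>L + 1\<close> digits and, for each
  \<open>s > 0\<close>, those that fit into \<open>L + s + 1\<close> digits but not into \<open>L + s\<close>. So among the lengths from
  \<open>L + 1\<close> on, the least one that suffices is the only one where the expansion satisfies the condition
  on overflow.\<close>

lemma expansion_with_surplus_exists:
  "\<exists>s ds. length ds = Suc (L + s) \<and> expansion ds \<and> (0 < s \<longrightarrow> overflows ds) \<and> digit_value ds = M"
proof -
  have "3 * \<bar>M\<bar> < 11 * 2 ^ (L + nat \<bar>M\<bar>)"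
  proof -
    have "nat \<bar>M\<bar> < 2 ^ nat \<bar>M\<bar>" by (rule less_exp)
    then have "int (nat \<bar>M\<bar>) < int (2 ^ nat \<bar>M\<bar>)" by (simp only: of_nat_less_iff)
    then have "\<bar>M\<bar> < 2 ^ nat \<bar>M\<bar>" by simp
    also have "\<dots> \<le> 2 ^ (L + nat \<bar>M\<bar>)" by (rule power_increasing) auto
    finally show ?thesis by linarith
  qed
  then have ex: "fits (L + nat \<bar>M\<bar>) M" by (simp add: fits_def)
  define s where "s = (LEAST s. fits (L + s) M)"
  have s: "fits (L + s) M" unfolding s_def by (rule LeastI, rule ex)
  then obtain ds where ds: "expansion ds" "length ds = Suc (L + s)" "digit_value ds = M"
    using expansion_exists by blast
  have "overflows ds" if "0 < s"
  proof -
    have "\<not> fits (L + (s - 1)) M"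
      using not_less_Least[of "s - 1" "\<lambda>s. fits (L + s) M"] that by (simp add: s_def)
    moreover have "length ds - 2 = L + (s - 1)" using ds that by simp
    ultimately show ?thesis using ds by (simp add: overflows_def)
  qed
  then show ?thesis using ds by blast
qed

lemma expansion_with_surplus_unique:
  assumes "length ds = Suc (L + s)" "expansion ds" "0 < s \<longrightarrow> overflows ds"
    and "length ds' = Suc (L + s')" "expansion ds'" "0 < s' \<longrightarrow> overflows ds'"
    and eq: "digit_value ds = digit_value ds'"
  shows "s = s' \<and> ds = ds'"
proof -
  have less: "\<not> r < r'"
    if "length es = Suc (L + r)" "expansion es" "length es' = Suc (L + r')"
      "0 < r' \<longrightarrow> overflows es'" "digit_value es = digit_value es'" for r r' es es'
  proof
    assume "r < r'"
    then have "\<not> fits (L + r' - 1) (digit_value es')" using that by (auto simp: overflows_def)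
    moreover have "fits (L + r) (digit_value es')" using expansion_fits[of es] that by simp
    ultimately show False using fits_mono[of "L + r" _ "L + r' - 1"] \<open>r < r'\<close> by auto
  qed
  have "s = s'" using less[of ds s ds' s'] less[of ds' s' ds s] assms by simp
  then show ?thesis using expansion_inj[of ds ds'] assms by simp
qed

section \<open>Dyadic numbers in lowest terms\<close>

text \<open>The denominator \<open>2\<^sup>c\<close> is granted in advance, and only the excess \<open>j\<close> over it has to be minimal.
  For words of nonpositive \<open>t\<close>-exponent \<open>n\<close> it is \<open>c = -n\<close>, because the \<open>t\<^sup>-\<^sup>1\<close> that are present anyway
  provide this denominator.\<close>

lemma dyadic_lowest_terms_exists:
  fixes x :: real
  assumes "x = of_int J / 2 ^ p"
  shows "\<exists>j M. x = of_int M / 2 ^ (c + j) \<and> (0 < j \<longrightarrow> odd M)"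
proof -
  let ?P = "\<lambda>j. \<exists>M::int. x = of_int M / 2 ^ (c + j)"
  have "?P p"
    using assms by (intro exI[of _ "J * 2 ^ c"]) (simp add: power_add field_simps)
  define j where "j = (LEAST j. ?P j)"
  have "?P j" unfolding j_def by (rule LeastI, rule \<open>?P p\<close>)
  then obtain M where M: "x = of_int M / 2 ^ (c + j)" by blast
  have "odd M" if "0 < j"
  proof
    assume "even M"
    then obtain R where "M = 2 * R" by blast
    moreover obtain i where "j = Suc i" using \<open>0 < j\<close> gr0_conv_Suc by blast
    ultimately have "x = of_int R / 2 ^ (c + i)" using M by simp
    then show False using not_less_Least[of i ?P] \<open>j = Suc i\<close> j_def by auto
  qed
  then show ?thesis using M by blast
qed

lemma dyadic_lowest_terms_unique:
  fixes M M' :: int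
  assumes eq: "(of_int M :: real) / 2 ^ (c + j) = of_int M' / 2 ^ (c + j')"
    and "0 < j \<longrightarrow> odd M" "0 < j' \<longrightarrow> odd M'"
  shows "j = j' \<and> M = M'"
proof -
  have less: "\<not> i < i'"
    if e: "(of_int N :: real) / 2 ^ (c + i) = of_int N' / 2 ^ (c + i')" and o: "0 < i' \<longrightarrow> odd N'"
    for i i' N N'
  proof
    assume "i < i'"
    then obtain r where r: "i' = Suc (i + r)" using less_iff_Suc_add by blast
    have "(of_int N' :: real) = of_int (N * 2 ^ Suc r)"
      using e by (simp add: r power_add field_simps)
    then have "N' = N * 2 ^ Suc r" by (simp only: of_int_eq_iff)
    then show False using o r by simp
  qed
  have "j = j'" using less[OF eq] less[OF eq[symmetric]] assms(2,3) by simp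
  then show ?thesis using eq by simp
qed

section \<open>Coordinates on BS(1,2)\<close>

text \<open>The left action of the letters on \<open>\<int>[1/2] \<times> \<int>\<close>, embedded in \<open>\<real> \<times> \<int>\<close>. The image of the origin
  \<open>(0, 0)\<close> gives the coordinates of a word.\<close>

fun act_letter :: "bs_gen \<times> bool \<Rightarrow> real \<times> int \<Rightarrow> real \<times> int" where
  "act_letter (gen_a, b) (x, n) = (if b then x + 1 else x - 1, n)"
| "act_letter (gen_t, b) (x, n) = (if b then (2 * x, n + 1) else (x / 2, n - 1))"

definition act :: "bs_gen word \<Rightarrow> real \<times> int \<Rightarrow> real \<times> int" where
  "act w = foldr act_letter w"

lemma act_Nil [simp]: "act [] p = p"
  and act_Cons: "act (c # w) p = act_letter c (act w p)"
  and act_append [simp]: "act (u @ v) p = act u (act v p)"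
  by (simp_all add: act_def)

lemma act_apow [simp]: "act (apow e) (x, n) = (x + of_int e, n)"
proof -
  have "act (replicate k (gen_a, b)) (x, n) = (if b then x + real k else x - real k, n)" for k b
    by (induction k) (auto simp: act_Cons)
  then show ?thesis by (simp add: gpow_def)
qed

lemma act_tpow_nonneg [simp]: "act (tpow (int m)) (x, n) = (2 ^ m * x, n + int m)"
proof -
  have "act (replicate m (gen_t, True)) (x, n) = (2 ^ m * x, n + int m)"
    by (induction m) (auto simp: act_Cons)
  then show ?thesis by (simp add: gpow_def)
qed

lemma act_tpow_nonpos [simp]: "act (tpow (- int m)) (x, n) = (x / 2 ^ m, n - int m)"
proof -
  have "act (replicate m (gen_t, False)) (x, n) = (x / 2 ^ m, n - int m)"
    by (induction m) (auto simp: act_Cons)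
  then show ?thesis by (cases "m = 0") (auto simp: gpow_def)
qed

lemmas act_tpow_1 [simp] = act_tpow_nonneg[of 1, simplified] act_tpow_nonpos[of 1, simplified]

lemma act_pres_eq:
  assumes "pres_eq bs_relations u v"
  shows "act u p = act v p"
  using assms
proof (induction arbitrary: p rule: pres_eq.induct)
  case (pres_rel u v)
  then show ?case
    by (cases p) (auto simp: bs_relations_def field_simps)
next
  case (pres_cancel g b)
  then show ?case by (cases p; cases g; cases b) (auto simp: act_Cons)
qed auto

lemma gpow_0 [simp]: "gpow g 0 = []" by (simp add: gpow_def)

lemma digit_value_append: "digit_value (ds @ es) = digit_value ds + 2 ^ length ds * digit_value es"
  by (simp add: horner_sum_append)

lemma act_N_run:
  "es \<noteq> [] \<Longrightarrow> act (N_run es) (x, n) =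
     ((of_int (digit_value (rev es)) + x) / 2 ^ (length es - 1), n - int (length es - 1))"
  by (induction es rule: N_run.induct) (auto simp: digit_value_append field_simps)

lemma act_P_run:
  "ds \<noteq> [] \<Longrightarrow> act (P_run ds) (x, n) =
     (of_int (digit_value ds) + 2 ^ (length ds - 1) * x, n + int (length ds - 1))"
  by (induction ds rule: P_run.induct) (auto simp: field_simps)

lemma (in group) conj_commute_int_pow:
  assumes "x \<in> carrier G" "y \<in> carrier G" "t \<in> carrier G" and eq: "t \<otimes> x = y \<otimes> t"
  shows "t \<otimes> x [^] (n::int) = y [^] n \<otimes> t"
proof -
  have nat: "t \<otimes> x [^] k = y [^] k \<otimes> t" for k :: nat
  proof (induction k)
    case (Suc k)
    have "t \<otimes> x [^] Suc k = (t \<otimes> x [^] k) \<otimes> x" using assms by (simp add: m_assoc)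
    also have "\<dots> = y [^] k \<otimes> (t \<otimes> x)" using assms Suc by (simp add: m_assoc)
    also have "\<dots> = y [^] Suc k \<otimes> t" using assms by (simp add: eq m_assoc)
    finally show ?case .
  qed (use assms in simp)
  show ?thesis
  proof (cases n rule: int_cases2)
    case (nonneg k)
    then show ?thesis using nat by (simp add: int_pow_int)
  next
    case (nonpos k)
    let ?x = "x [^] k" and ?y = "y [^] k"
    have "?y \<otimes> (t \<otimes> inv ?x) = (?y \<otimes> t) \<otimes> inv ?x" using assms by (simp add: m_assoc)
    also have "\<dots> = t" using assms by (simp add: nat[symmetric] m_assoc)
    finally have "t \<otimes> inv ?x = inv ?y \<otimes> t"
      using assms by (simp add: inv_solve_left)
    then show ?thesis using assms nonpos by (simp add: int_pow_neg_int)
  qed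
qed

lemma word_class_gpow:
  "word_class R (gpow g n) = word_class R [(g, True)] [^]\<^bsub>presented_group R\<^esub> n"
proof -
  interpret group "presented_group R" by (rule group_presented_group)
  have closed: "word_class R w \<in> carrier (presented_group R)" for w
    by (simp add: carrier_presented_group)
  have letters: "word_class R (replicate k (g, b)) = word_class R [(g, b)] [^]\<^bsub>presented_group R\<^esub> k" for k b
  proof (induction k)
    case (Suc k)
    have "word_class R (replicate (Suc k) (g, b)) = word_class R (replicate k (g, b) @ [(g, b)])"
      by (simp add: replicate_append_same)
    then show ?case by (simp add: mult_presented_group[symmetric] Suc)
  qed (simp add: one_presented_group)
  show ?thesis
  proof (cases n rule: int_cases2)
    case (nonneg k)
    then show ?thesis by (simp add: gpow_def letters int_pow_int)
  next
    case (nonpos k)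
    then show ?thesis
      by (cases "k = 0")
        (simp_all add: gpow_def letters int_pow_neg_int closed nat_pow_inv one_presented_group flip: inv_letter)
  qed
qed

interpretation BS12: group BS12
  unfolding BS12_def by (rule group_presented_group)

abbreviation elt :: "bs_gen word \<Rightarrow> bs_gen word set" where
  "elt \<equiv> word_class bs_relations"
abbreviation aelt :: "int \<Rightarrow> bs_gen word set" where
  "aelt n \<equiv> elt (apow n)"
abbreviation telt :: "int \<Rightarrow> bs_gen word set" where
  "telt n \<equiv> elt (tpow n)"

lemma elt_closed [simp]: "elt w \<in> carrier BS12"
  by (simp add: BS12_def carrier_presented_group)

lemma elt_append: "elt (u @ v) = elt u \<otimes>\<^bsub>BS12\<^esub> elt v"
  by (simp add: BS12_def mult_presented_group)

lemma elt_Nil [simp]: "elt [] = \<one>\<^bsub>BS12\<^esub>"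
  by (simp add: BS12_def one_presented_group)

lemma aelt_mult: "aelt m \<otimes>\<^bsub>BS12\<^esub> aelt n = aelt (m + n)"
  and telt_mult: "telt m \<otimes>\<^bsub>BS12\<^esub> telt n = telt (m + n)"
proof -
  have "elt (gpow g m) \<otimes>\<^bsub>BS12\<^esub> elt (gpow g n) =
      elt (gpow g (m + n))" for g
    unfolding word_class_gpow BS12_def[symmetric] by (rule BS12.int_pow_mult[symmetric]) simp
  then show "aelt m \<otimes>\<^bsub>BS12\<^esub> aelt n = aelt (m + n)" "telt m \<otimes>\<^bsub>BS12\<^esub> telt n = telt (m + n)"
    by blast+
qed

lemma telt_aelt: "telt 1 \<otimes>\<^bsub>BS12\<^esub> aelt n = aelt (2 * n) \<otimes>\<^bsub>BS12\<^esub> telt 1"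
proof -
  have "(tpow 1 @ apow 1 @ tpow (- 1), apow 2) \<in> bs_relations" by (simp add: bs_relations_def)
  then have "elt (tpow 1 @ apow 1 @ tpow (- 1)) = aelt 2"
    unfolding word_class_eq_iff by (rule pres_rel)
  then have "(telt 1 \<otimes>\<^bsub>BS12\<^esub> (aelt 1 \<otimes>\<^bsub>BS12\<^esub> telt (- 1))) \<otimes>\<^bsub>BS12\<^esub> telt 1 = aelt 2 \<otimes>\<^bsub>BS12\<^esub> telt 1"
    by (simp add: elt_append)
  then have rel: "telt 1 \<otimes>\<^bsub>BS12\<^esub> aelt 1 = aelt 2 \<otimes>\<^bsub>BS12\<^esub> telt 1"
    by (simp add: BS12.m_assoc telt_mult)
  have "telt 1 \<otimes>\<^bsub>BS12\<^esub> aelt 1 [^]\<^bsub>BS12\<^esub> n = aelt 2 [^]\<^bsub>BS12\<^esub> n \<otimes>\<^bsub>BS12\<^esub> telt 1"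
    by (rule BS12.conj_commute_int_pow[OF _ _ _ rel]) simp_all
  moreover have "aelt e [^]\<^bsub>BS12\<^esub> n = aelt (e * n)" for e
    unfolding word_class_gpow BS12_def[symmetric] by (rule BS12.int_pow_pow) simp
  ultimately show ?thesis by simp
qed

lemma aelt_telt_neg:
  "aelt e \<otimes>\<^bsub>BS12\<^esub> telt (- int p) = telt (- int p) \<otimes>\<^bsub>BS12\<^esub> aelt (2 ^ p * e)"
proof (induction p arbitrary: e)
  case (Suc p)
  have step: "aelt e \<otimes>\<^bsub>BS12\<^esub> telt (- 1) = telt (- 1) \<otimes>\<^bsub>BS12\<^esub> aelt (2 * e)" for e
  proof -
    have "aelt e \<otimes>\<^bsub>BS12\<^esub> telt (- 1) =
        telt (- 1) \<otimes>\<^bsub>BS12\<^esub> (telt 1 \<otimes>\<^bsub>BS12\<^esub> aelt e) \<otimes>\<^bsub>BS12\<^esub> telt (- 1)"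
      by (simp add: BS12.m_assoc[symmetric] telt_mult)
    also have "\<dots> = telt (- 1) \<otimes>\<^bsub>BS12\<^esub> aelt (2 * e) \<otimes>\<^bsub>BS12\<^esub> (telt 1 \<otimes>\<^bsub>BS12\<^esub> telt (- 1))"
      unfolding telt_aelt by (simp add: BS12.m_assoc)
    finally show ?thesis by (simp add: telt_mult)
  qed
  have "aelt e \<otimes>\<^bsub>BS12\<^esub> telt (- int (Suc p)) = (aelt e \<otimes>\<^bsub>BS12\<^esub> telt (- int p)) \<otimes>\<^bsub>BS12\<^esub> telt (- 1)"
    by (simp add: BS12.m_assoc telt_mult minus_diff_commute)
  also have "\<dots> = telt (- int p) \<otimes>\<^bsub>BS12\<^esub> (aelt (2 ^ p * e) \<otimes>\<^bsub>BS12\<^esub> telt (- 1))"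
    by (simp add: Suc.IH BS12.m_assoc)
  also have "\<dots> = telt (- int (Suc p)) \<otimes>\<^bsub>BS12\<^esub> aelt (2 ^ Suc p * e)"
    unfolding step
    by (simp add: BS12.m_assoc[symmetric] telt_mult minus_diff_commute mult.assoc)
  finally show ?case .
qed simp

text \<open>Words \<open>t\<^sup>-\<^sup>pa\<^sup>jt\<^sup>q\<close> represent all elements, though not uniquely: \<open>p\<close> can be increased. This lets
  two of them be compared with a common \<open>p\<close>, where the coordinates determine \<open>j\<close> and \<open>q\<close>.\<close>

abbreviation tat :: "nat \<Rightarrow> int \<Rightarrow> int \<Rightarrow> bs_gen word" where
  "tat p j q \<equiv> tpow (- int p) @ apow j @ tpow q"

lemma elt_tat:
  "elt (tat p j q) = telt (- int p) \<otimes>\<^bsub>BS12\<^esub> (aelt j \<otimes>\<^bsub>BS12\<^esub> telt q)"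
  by (simp add: elt_append)

lemma elt_tat_shift:
  "elt (tat p j q) = elt (tat (p + r) (2 ^ r * j) (q + int r))"
proof -
  have "elt (tat (p + r) (2 ^ r * j) (q + int r)) =
     (telt (- int p) \<otimes>\<^bsub>BS12\<^esub> telt (- int r)) \<otimes>\<^bsub>BS12\<^esub> (aelt (2 ^ r * j) \<otimes>\<^bsub>BS12\<^esub> (telt (int r) \<otimes>\<^bsub>BS12\<^esub> telt q))"
    unfolding elt_tat by (simp add: telt_mult add.commute)
  also have "\<dots> = telt (- int p) \<otimes>\<^bsub>BS12\<^esub> ((telt (- int r) \<otimes>\<^bsub>BS12\<^esub> aelt (2 ^ r * j)) \<otimes>\<^bsub>BS12\<^esub> (telt (int r) \<otimes>\<^bsub>BS12\<^esub> telt q))"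
    by (simp only: BS12.m_assoc elt_closed BS12.m_closed)
  also have "\<dots> = telt (- int p) \<otimes>\<^bsub>BS12\<^esub> (aelt j \<otimes>\<^bsub>BS12\<^esub> (telt (- int r) \<otimes>\<^bsub>BS12\<^esub> telt (int r) \<otimes>\<^bsub>BS12\<^esub> telt q))"
    unfolding aelt_telt_neg[symmetric] by (simp only: BS12.m_assoc elt_closed BS12.m_closed)
  also have "\<dots> = elt (tat p j q)"
    by (simp add: telt_mult elt_tat)
  finally show ?thesis ..
qed

lemma elt_eq_tat: "\<exists>p j q. elt w = elt (tat p j q)"
proof (induction w)
  case Nil
  show ?case by (rule exI[of _ 0], rule exI[of _ 0], rule exI[of _ 0]) simp
next
  case (Cons c w)
  then obtain p j q where w: "elt w = elt (tat p j q)"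
    by blast
  have c: "elt (c # w) = elt [c] \<otimes>\<^bsub>BS12\<^esub> elt (tat p j q)"
    using elt_append[of "[c]" w] w by simp
  obtain g b where gb: "c = (g, b)" by (cases c)
  define e :: int where "e = (if b then 1 else - 1)"
  have letter: "[c] = gpow g e" by (simp add: e_def gb gpow_def)
  show ?case
  proof (cases g)
    case gen_a
    have "elt (c # w) =
        (aelt e \<otimes>\<^bsub>BS12\<^esub> telt (- int p)) \<otimes>\<^bsub>BS12\<^esub> (aelt j \<otimes>\<^bsub>BS12\<^esub> telt q)"
      unfolding c letter gen_a elt_tat by (simp add: BS12.m_assoc)
    also have "\<dots> = telt (- int p) \<otimes>\<^bsub>BS12\<^esub> (aelt (2 ^ p * e) \<otimes>\<^bsub>BS12\<^esub> aelt j \<otimes>\<^bsub>BS12\<^esub> telt q)"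
      unfolding aelt_telt_neg by (simp add: BS12.m_assoc)
    also have "\<dots> = elt (tat p (2 ^ p * e + j) q)"
      by (simp add: aelt_mult elt_tat)
    finally show ?thesis by blast
  next
    case gen_t
    \<comment> \<open>Increasing \<open>p\<close> beforehand makes sure that it does not become negative when \<open>t\<close> is absorbed.\<close>
    have shift: "elt (tat p j q) = elt (tat (p + 1) (2 * j) (q + 1))"
      using elt_tat_shift[of p j q 1] by simp
    have "elt (c # w) =
        (telt e \<otimes>\<^bsub>BS12\<^esub> telt (- int (p + 1))) \<otimes>\<^bsub>BS12\<^esub> (aelt (2 * j) \<otimes>\<^bsub>BS12\<^esub> telt (q + 1))"
      unfolding c shift letter gen_t by (simp only: elt_tat BS12.m_assoc elt_closed BS12.m_closed)
    also have "\<dots> = elt (tat (nat (int p + 1 - e)) (2 * j) (q + 1))"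
    proof -
      have "e + - int (p + 1) = - int (nat (int p + 1 - e))" by (simp add: e_def)
      then show ?thesis by (simp only: telt_mult elt_tat)
    qed
    finally show ?thesis by blast
  qed
qed

lemma act_tat: "act (tat p j q) (0, 0) = (of_int j / 2 ^ p, q - int p)"
proof -
  have "act (tpow q) (0, 0) = (0, q)"
    using act_tpow_nonneg[of "nat q" 0 0] act_tpow_nonpos[of "nat (- q)" 0 0] by (cases "0 \<le> q") auto
  then show ?thesis by simp
qed

lemma act_elt:
  "elt u = elt v \<Longrightarrow> act u p = act v p"
  by (simp add: word_class_eq_iff act_pres_eq)

text \<open>This is what existence needs: a word with the right coordinates represents the right element.
  Both words are brought to the form \<open>t\<^sup>-\<^sup>Pa\<^sup>jt\<^sup>q\<close> with the same \<open>P = p + p'\<close>.\<close>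

lemma act_faithful:
  assumes "act u (0, 0) = act v (0, 0)"
  shows "elt u = elt v"
proof -
  obtain p j q where u: "elt u = elt (tat p j q)"
    using elt_eq_tat by blast
  obtain p' j' q' where v: "elt v = elt (tat p' j' q')"
    using elt_eq_tat by blast
  have eq: "(of_int j :: real) / 2 ^ p = of_int j' / 2 ^ p'" "q - int p = q' - int p'"
    using assms act_elt[OF u] act_elt[OF v] by (simp_all only: act_tat prod.inject)
  then have "(of_int (2 ^ p' * j) :: real) = of_int (2 ^ p * j')"
    by (simp add: field_simps)
  then have "2 ^ p' * j = 2 ^ p * j'" by (simp only: of_int_eq_iff)
  moreover have "q + int p' = q' + int p" using eq(2) by simp
  ultimately have "tat (p + p') (2 ^ p' * j) (q + int p') = tat (p' + p) (2 ^ p * j') (q' + int p)"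
    by (simp add: add.commute)
  then show ?thesis unfolding u v elt_tat_shift[of p j q p'] elt_tat_shift[of p' j' q' p]
    by simp
qed

section \<open>Long runs: the admissible prefixes and suffixes\<close>

lemma mem_with_negatives: "es \<in> with_negatives S \<longleftrightarrow> es \<in> S \<or> map uminus es \<in> S"
proof -
  have "es \<in> map uminus ` S \<longleftrightarrow> map uminus es \<in> S"
  proof
    assume "map uminus es \<in> S"
    then have "map uminus (map uminus es) \<in> map uminus ` S" by (rule imageI)
    then show "es \<in> map uminus ` S" by (simp add: o_def)
  qed (auto simp: o_def)
  then show ?thesis by (simp add: with_negatives_def)
qed

text \<open>The next two lemmas show that the published conditions propagate by adding a digit at the low end,
  which is the last entry of an \<open>N\<close>-run and the first one of a \<open>P\<close>-run, in the same way as
  \<open>expansion\<close> does by \<open>expansion_Cons\<close>. It then suffices to compare them for three digits.\<close>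

lemma long_N_snoc:
  assumes "3 \<le> length es"
  shows "long_N S (es @ [e]) \<longleftrightarrow> long_N S es \<and> e \<in> {0, 1, - 1} \<and> (e = 0 \<or> last es = 0)"
proof -
  let ?Q = "\<lambda>es i. es ! i = 0 \<or> es ! Suc i = (0::int)"
  obtain p where p: "length es = Suc p" "2 \<le> p" using assms by (cases "length es") auto
  have "(\<forall>i. 2 \<le> i \<and> Suc i < length (es @ [e]) \<longrightarrow> R i) \<longleftrightarrow>
      (\<forall>i. 2 \<le> i \<and> Suc i < length es \<longrightarrow> R i) \<and> R (length es - 1)" for R
    using p by (simp add: less_Suc_eq) blast
  moreover have "?Q (es @ [e]) i \<longleftrightarrow> ?Q es i" if "Suc i < length es" for i
    using that by (simp add: nth_append)
  ultimately have "(\<forall>i. 2 \<le> i \<and> Suc i < length (es @ [e]) \<longrightarrow> ?Q (es @ [e]) i) \<longleftrightarrow>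
      (\<forall>i. 2 \<le> i \<and> Suc i < length es \<longrightarrow> ?Q es i) \<and> ?Q (es @ [e]) (length es - 1)"
    by simp
  moreover have "?Q (es @ [e]) (length es - 1) \<longleftrightarrow> e = 0 \<or> last es = 0"
    using assms by (auto simp: nth_append last_conv_nth)
  moreover have "take 3 (es @ [e]) = take 3 es" "set (drop 3 (es @ [e])) = insert e (set (drop 3 es))"
    using assms by auto
  ultimately show ?thesis
    unfolding long_N_def by (simp only: insert_subset conj_ac)
qed

lemma long_P_Cons:
  assumes "3 \<le> length ds"
  shows "long_P S (b # ds) \<longleftrightarrow> long_P S ds \<and> b \<in> {0, 1, - 1} \<and> (b = 0 \<or> hd ds = 0)"
proof -
  have len: "length (b # ds) - 3 = Suc (length ds - 3)" using assms by simp
  have "ds ! 0 = hd ds" using assms by (cases ds) auto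
  moreover have "drop (length (b # ds) - 3) (b # ds) = drop (length ds - 3) ds"
    "set (take (length (b # ds) - 3) (b # ds)) = insert b (set (take (length ds - 3) ds))"
    by (simp_all only: len drop_Suc_Cons take_Suc_Cons list.set)
  moreover have "(\<forall>i < length (b # ds) - 3. (b # ds) ! i = 0 \<or> (b # ds) ! Suc i = 0) \<longleftrightarrow>
      (b = 0 \<or> ds ! 0 = 0) \<and> (\<forall>i < length ds - 3. ds ! i = 0 \<or> ds ! Suc i = 0)"
    by (simp only: len All_less_Suc2 nth_Cons_0 nth_Cons_Suc)
  ultimately show ?thesis
    unfolding long_P_def by (simp only: insert_subset) blast
qed

lemma length_2_obtain:
  assumes "length ds = 2" obtains c d where "ds = [c, d]"
  using assms by (auto simp: length_Suc_conv eval_nat_numeral)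

lemma length_3_obtain:
  assumes "length ds = 3" obtains b c d where "ds = [b, c, d]"
  using assms by (auto simp: length_Suc_conv eval_nat_numeral)

lemma three_digit_induct [consumes 1, case_names three Cons]:
  assumes "3 \<le> length ds"
    and "\<And>b c d. P [b, c, d]"
    and "\<And>b ds. 3 \<le> length ds \<Longrightarrow> P ds \<Longrightarrow> P (b # ds)"
  shows "P ds"
  using assms(1)
proof (induction ds)
  case (Cons b ds)
  show ?case
  proof (cases "3 \<le> length ds")
    case True
    then show ?thesis using Cons assms(3) by blast
  next
    case False
    then have "length ds = 2" using Cons.prems by simp
    then obtain c d where "ds = [c, d]" by (rule length_2_obtain)
    then show ?thesis using assms(2) by simp
  qed
qed simp

lemma three_digit_prefixes_N: "[d, c, b] \<in> with_negatives prefixes_N \<longleftrightarrow> expansion [b, c, d]"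
proof
  assume "expansion [b, c, d]"
  moreover note three_digit_expansion_cases[OF this]
  ultimately show "[d, c, b] \<in> with_negatives prefixes_N"
    unfolding mem_with_negatives prefixes_N_def by (elim disjE) simp_all
next
  assume "[d, c, b] \<in> with_negatives prefixes_N"
  then show "expansion [b, c, d]"
    unfolding mem_with_negatives prefixes_N_def
    by (elim disjE insertE emptyE) simp_all
qed

text \<open>The seven prefixes of the types \<open>X\<close> are the expansions of \<open>8, \<dots>, 14\<close>, the positive values that fit into three
  digits but not into two. In particular \<open>20(-1)\<close> is missing among them since its value is \<open>7\<close>.\<close>

lemma three_digit_prefixes_X:
  "[d, c, b] \<in> with_negatives prefixes_X \<longleftrightarrow> expansion [b, c, d] \<and> overflows [b, c, d]"
proof
  assume "expansion [b, c, d] \<and> overflows [b, c, d]"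
  then have "expansion [b, c, d]" "overflows [b, c, d]" by auto
  moreover note three_digit_expansion_cases[OF this(1)]
  ultimately show "[d, c, b] \<in> with_negatives prefixes_X"
    unfolding mem_with_negatives prefixes_X_def overflows_def fits_def
    by (elim disjE) simp_all
next
  assume "[d, c, b] \<in> with_negatives prefixes_X"
  then show "expansion [b, c, d] \<and> overflows [b, c, d]"
    unfolding mem_with_negatives prefixes_X_def overflows_def fits_def
    by (elim disjE insertE emptyE) simp_all
qed

lemma three_digit_suffixes:
  "[b, c, d] \<in> with_negatives suffixes_P \<longleftrightarrow> [d, c, b] \<in> with_negatives prefixes_N"
  "[b, c, d] \<in> with_negatives suffixes_PX \<longleftrightarrow> [d, c, b] \<in> with_negatives prefixes_X"
  unfolding mem_with_negatives suffixes_P_def prefixes_N_def suffixes_PX_def prefixes_X_def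
  by (simp_all only: list.map insert_iff empty_iff list.inject conj_ac)

lemma long_run_iff:
  assumes "3 \<le> length ds"
  shows "long_N prefixes_N (rev ds) \<longleftrightarrow> expansion ds"
    and "long_N prefixes_X (rev ds) \<longleftrightarrow> expansion ds \<and> overflows ds"
    and "long_P suffixes_P ds \<longleftrightarrow> expansion ds"
    and "long_P suffixes_PX ds \<longleftrightarrow> expansion ds \<and> overflows ds"
  using assms
proof (induction ds rule: three_digit_induct)
  case (three b c d)
  {
    case 1 show ?case using three_digit_prefixes_N[of d c b] by (simp add: long_N_def)
  next
    case 2 show ?case using three_digit_prefixes_X[of d c b] by (simp add: long_N_def)
  next
    case 3 show ?case using three_digit_suffixes(1)[of b c d] three_digit_prefixes_N[of d c b]
      by (simp add: long_P_def)
  next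
    case 4 show ?case using three_digit_suffixes(2)[of b c d] three_digit_prefixes_X[of d c b]
      by (simp add: long_P_def)
  }
next
  case (Cons b ds)
  have e: "expansion (b # ds) \<longleftrightarrow> b \<in> {0, 1, - 1} \<and> (b = 0 \<or> hd ds = 0) \<and> expansion ds"
    using Cons by (intro expansion_Cons) simp
  have o: "overflows (b # ds) \<longleftrightarrow> overflows ds" if "b \<in> {0, 1, - 1}" "b = 0 \<or> hd ds = 0"
    using overflows_Cons[of ds b] Cons.hyps that by simp
  have l: "last (rev ds) = hd ds" using Cons.hyps by (cases ds) auto
  {
    case 1 show ?case using Cons e by (simp add: long_N_snoc l) blast
  next
    case 2 show ?case using Cons e o by (simp add: long_N_snoc l) blast
  next
    case 3 show ?case using Cons e by (simp add: long_P_Cons) blast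
  next
    case 4 show ?case using Cons e o by (simp add: long_P_Cons) blast
  }
qed

section \<open>Short runs: the tables\<close>

lemma signs_Nil [simp]: "es \<in> signs [] \<longleftrightarrow> es = []"
  by (simp add: signs_def)

lemma Cons_signs_Cons [simp]: "d # ds \<in> signs (a # as) \<longleftrightarrow> \<bar>d\<bar> = \<bar>a\<bar> \<and> ds \<in> signs as"
  by (simp add: signs_def)

lemma signs_ConsE:
  assumes "es \<in> signs (a # as)"
  obtains ds where "es = a # ds" "ds \<in> signs as" | ds where "es = - a # ds" "ds \<in> signs as"
  using assms by (cases es) (auto simp: signs_def abs_eq_iff)

text \<open>The exponents of \<open>a\<close> between successive letters \<open>t\<^sup>\<plusminus>\<^sup>1\<close>. They recover the entries of a run
  from the word. This separates the words of the second table from those that its correction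
  deletes, which is a matter of words and not of group elements.\<close>

fun gap_exponents :: "bs_gen word \<Rightarrow> int list" where
  "gap_exponents [] = [0]"
| "gap_exponents ((gen_a, b) # w) =
     (hd (gap_exponents w) + (if b then 1 else - 1)) # tl (gap_exponents w)"
| "gap_exponents ((gen_t, b) # w) = 0 # gap_exponents w"

lemma gap_exponents_apow:
  "gap_exponents w = f # fs \<Longrightarrow> gap_exponents (apow e @ w) = (e + f) # fs"
proof -
  assume w: "gap_exponents w = f # fs"
  have "gap_exponents (replicate k (gen_a, b) @ w) = (f + (if b then int k else - int k)) # fs" for k b
    by (induction k) (auto simp: w)
  then show ?thesis by (simp add: gpow_def)
qed

lemma gap_exponents_tpow: "gap_exponents (tpow m @ w) = replicate (nat \<bar>m\<bar>) 0 @ gap_exponents w"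
proof -
  have "gap_exponents (replicate k (gen_t, b) @ w) = replicate k 0 @ gap_exponents w" for k b
    by (induction k) auto
  then show ?thesis by (simp add: gpow_def)
qed

lemma gap_exponents_N_run:
  "es \<noteq> [] \<Longrightarrow> gap_exponents (N_run es @ tpow m) = es @ replicate (nat \<bar>m\<bar>) 0"
proof (induction es rule: N_run.induct)
  case (2 e)
  have "gap_exponents (tpow m @ []) = 0 # replicate (nat \<bar>m\<bar>) 0"
    unfolding gap_exponents_tpow by (simp add: replicate_append_same)
  then show ?case by (simp add: gap_exponents_apow)
next
  case (3 e e' es)
  have "gap_exponents (tpow (- 1) @ N_run (e' # es) @ tpow m) =
      0 # (e' # es) @ replicate (nat \<bar>m\<bar>) 0"
    using 3 by (simp add: gap_exponents_tpow)
  then show ?case by (simp add: gap_exponents_apow)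
qed simp

text \<open>The tables for \<open>l \<le> 2\<close> are finite, and membership is decided by running through the values of
  the digits. The rules \<open>UnI1\<close> and \<open>UnI2\<close> select the family of words within the table.\<close>

lemma L2_printed_intros:
  "expansion [c, d] \<Longrightarrow> N_run [d, c] \<in> L2_printed"
  "expansion [c, d] \<Longrightarrow> c \<noteq> 0 \<Longrightarrow> N_run [d, c] @ tpow 1 \<in> L2_printed"
  "expansion [b, c, d] \<Longrightarrow> N_run [d, c, b] \<in> L2_printed"
  "expansion [b, c, d] \<Longrightarrow> b \<noteq> 0 \<Longrightarrow> m \<in> {1, 2} \<Longrightarrow> N_run [d, c, b] @ tpow m \<in> L2_printed"
proof -
  assume *: "expansion [c, d]"
  show "N_run [d, c] \<in> L2_printed"
    unfolding L2_printed_def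
    apply (rule UnI1, rule UnI1, rule UnI1, rule CollectI, rule exI, rule conjI, rule refl)
    using * two_digit_expansion_cases[OF *] by (elim disjE) simp_all
  assume "c \<noteq> 0"
  then show "N_run [d, c] @ tpow 1 \<in> L2_printed"
    unfolding L2_printed_def
    apply -
    apply (rule UnI1, rule UnI1, rule UnI2, rule CollectI, rule exI, rule conjI, rule refl)
    using * two_digit_expansion_cases[OF *] by (elim disjE) simp_all
next
  assume *: "expansion [b, c, d]"
  show "N_run [d, c, b] \<in> L2_printed"
    unfolding L2_printed_def
    apply (rule UnI1, rule UnI2, rule CollectI, rule exI, rule conjI, rule refl)
    using * three_digit_expansion_cases[OF *] by (elim disjE) simp_all
  assume "b \<noteq> 0" "m \<in> {1, 2}"
  then show "N_run [d, c, b] @ tpow m \<in> L2_printed"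
    unfolding L2_printed_def
    apply -
    apply (rule UnI2, rule CollectI, rule exI, rule exI, rule conjI, rule refl, rule conjI, assumption)
    using * three_digit_expansion_cases[OF *] by (elim disjE) simp_all
qed

text \<open>The entries of the words that are deleted from the second table. They are recognised by an entry
  \<open>\<plusminus>2\<close> or \<open>\<plusminus>3\<close> which is not the first one, whereas in an expansion only the highest digit, the first
  entry of an \<open>N\<close>-run, can be that large.\<close>

abbreviation redundant_entries :: "int list set" where
  "redundant_entries \<equiv> signs [0,2] \<union> signs [0,3] \<union> signs [0,2,0] \<union> signs [0,3,0] \<union>
     signs [0,0,2] \<union> signs [0,0,3]"

lemma L2_intro:
  assumes "expansion ds" "length ds \<in> {2, 3}" "k < length ds" "0 < k \<longrightarrow> hd ds \<noteq> 0"
  shows "N_run (rev ds) @ tpow (int k) \<in> L2"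
proof -
  let ?w = "N_run (rev ds) @ tpow (int k)"
  have "?w \<in> L2_printed"
  proof (cases "length ds = 2")
    case True
    then obtain c d where "ds = [c, d]" by (rule length_2_obtain)
    moreover have "k = 0 \<or> k = 1" using assms True by auto
    ultimately show ?thesis using L2_printed_intros(1,2)[of c d] assms
      by (auto simp del: N_run.simps expansion.simps)
  next
    case False
    then obtain b c d where "ds = [b, c, d]"
      using assms length_3_obtain by blast
    moreover from this have "k = 0 \<or> k = 1 \<or> k = 2" using assms by auto
    moreover from calculation have "expansion [b, c, d]" "0 < k \<longrightarrow> b \<noteq> 0"
      using assms by simp_all
    ultimately show ?thesis
      using L2_printed_intros(3)[of b c d] L2_printed_intros(4)[of b c d 1] L2_printed_intros(4)[of b c d 2]
      by (elim disjE) (simp_all del: N_run.simps expansion.simps)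
  qed
  moreover have "gap_exponents ?w = rev ds @ replicate k 0"
    using gap_exponents_N_run[of "rev ds" "int k"] \<open>k < length ds\<close> by force
  then have small: "\<forall>e \<in> set (tl (gap_exponents ?w)). \<bar>e\<bar> \<le> 1"
    using assms by (auto simp: length_Suc_conv eval_nat_numeral)
  have large: "N_run es @ tpow m \<noteq> ?w" if "\<exists>e \<in> set (tl es). 1 < \<bar>e\<bar>" for es m
  proof
    assume "N_run es @ tpow m = ?w"
    moreover have "es \<noteq> []" using that by auto
    ultimately have "gap_exponents ?w = es @ replicate (nat \<bar>m\<bar>) 0"
      using gap_exponents_N_run[of es m] by simp
    then have "set (tl es) \<subseteq> set (tl (gap_exponents ?w))" using \<open>es \<noteq> []\<close> by auto
    then show False using small that by fastforce
  qed
  have large0: "N_run es \<noteq> ?w" if "\<exists>e \<in> set (tl es). 1 < \<bar>e\<bar>" for es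
    using large[OF that, of 0] by simp
  have "\<exists>e \<in> set (tl es). 1 < \<bar>e\<bar>"
    if "es \<in> redundant_entries" for es
    using that by (elim UnE signs_ConsE; simp)
  note removed = large[OF this] large0[OF this]
  have ne: "?w \<noteq> N_run es @ tpow m" "?w \<noteq> N_run es"
    if "es \<in> redundant_entries" for es m
    using removed[OF that] by metis+
  show ?thesis unfolding L2_def
  proof (intro DiffI notI)
    show "?w \<in> L2_printed" by fact
  qed (elim UnE CollectE exE conjE; erule notE[rotated], rule ne, simp)
qed

lemma L2_cases:
  assumes "w \<in> L2"
  shows "\<exists>ds k. w = N_run (rev ds) @ tpow (int k) \<and> expansion ds \<and> k < length ds \<and>
    (0 < k \<longrightarrow> hd ds \<noteq> 0)"
proof -
  let ?G = "\<lambda>w. \<exists>ds k. w = N_run (rev ds) @ tpow (int k) \<and> expansion ds \<and> k < length ds \<and>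
    (0 < k \<longrightarrow> hd ds \<noteq> 0)"
  have removed: "N_run es \<noteq> w" if "es \<in> redundant_entries" for es
    using assms that unfolding L2_def by blast
  have removed1: "N_run es @ tpow 1 \<noteq> w" if "es \<in> signs [0,2] \<union> signs [0,3]" for es
    using assms that unfolding L2_def by blast
  have removed2: "N_run es @ tpow k \<noteq> w"
    if "es \<in> signs [0,0,2] \<union> signs [0,0,3]" "k \<in> {1, 2}" for es k
    using assms that unfolding L2_def by blast
  \<comment> \<open>The disjuncts other than the first one are the deleted words.\<close>
  have G: "?G w"
    if "w = N_run es @ tpow j" "0 \<le> j"
      "expansion (rev es) \<and> j < int (length es) \<and> (0 < j \<longrightarrow> hd (rev es) \<noteq> 0) \<or>
       j = 1 \<and> es \<in> signs [0,2] \<union> signs [0,3] \<or>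
       j \<in> {1, 2} \<and> es \<in> signs [0,0,2] \<union> signs [0,0,3]" for es j
  proof -
    have "expansion (rev es) \<and> j < int (length es) \<and> (0 < j \<longrightarrow> hd (rev es) \<noteq> 0)"
      using that removed1[of es] removed2[of es j] by blast
    then show ?thesis
      using that(1,2) by (intro exI[of _ "rev es"] exI[of _ "nat j"]) auto
  qed
  have G0: "?G w" if "w = N_run es" "expansion (rev es) \<or> es \<in> redundant_entries" for es
  proof -
    have "expansion (rev es)" using that removed[of es] by blast
    then show ?thesis using G[of es 0] that by (cases es) auto
  qed
  have "w \<in> L2_printed" using assms by (simp add: L2_def)
  then show ?thesis unfolding L2_printed_def
    by - (elim UnE CollectE exE conjE; (rule G0, assumption | rule G, assumption);
        elim signs_ConsE insertE emptyE; simp)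
qed

lemma L1_cases:
  assumes "w \<in> L1"
  shows "\<exists>k ds m. w = tpow (int k) @ N_run (rev ds) @ tpow (int m) \<and> expansion ds \<and>
    0 < k \<and> k + m < length ds \<and> (0 < m \<longrightarrow> hd ds \<noteq> 0) \<and> overflows ds"
proof -
  let ?G = "\<lambda>w. \<exists>k ds m. w = tpow (int k) @ N_run (rev ds) @ tpow (int m) \<and> expansion ds \<and>
    0 < k \<and> k + m < length ds \<and> (0 < m \<longrightarrow> hd ds \<noteq> 0) \<and> overflows ds"
  have G: "?G w"
    if "w = tpow i @ N_run es @ tpow j" "0 < i" "0 \<le> j"
      "expansion (rev es) \<and> overflows (rev es) \<and> i + j < int (length es) \<and> (0 < j \<longrightarrow> hd (rev es) \<noteq> 0)"
    for i es j
    using that by (intro exI[of _ "nat i"] exI[of _ "rev es"] exI[of _ "nat j"]) auto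
  have G0: "?G w"
    if "w = tpow i @ N_run es" "0 < i" "expansion (rev es) \<and> overflows (rev es) \<and> i < int (length es)"
    for i es
    using G[of i es 0] that by auto
  show ?thesis using assms unfolding L1_def
    by - (elim UnE CollectE exE conjE; (rule G, assumption | rule G0, assumption);
        elim signs_ConsE insertE emptyE; simp add: overflows_def fits_def)
qed

lemma L1_intros:
  "expansion [c, d] \<Longrightarrow> overflows [c, d] \<Longrightarrow> tpow 1 @ N_run [d, c] \<in> L1"
  "expansion [b, c, d] \<Longrightarrow> overflows [b, c, d] \<Longrightarrow> m \<in> {1, 2} \<Longrightarrow>
     tpow m @ N_run [d, c, b] \<in> L1"
  "expansion [b, c, d] \<Longrightarrow> overflows [b, c, d] \<Longrightarrow> b \<noteq> 0 \<Longrightarrow>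
     tpow 1 @ N_run [d, c, b] @ tpow 1 \<in> L1"
proof -
  assume *: "expansion [c, d]" "overflows [c, d]"
  show "tpow 1 @ N_run [d, c] \<in> L1"
    unfolding L1_def
    apply (rule UnI1, rule UnI1, rule CollectI, rule exI, rule conjI, rule refl)
    using * two_digit_expansion_cases[OF *(1)] unfolding overflows_def fits_def
    by (elim disjE) simp_all
next
  assume *: "expansion [b, c, d]" "overflows [b, c, d]"
  show "tpow m @ N_run [d, c, b] \<in> L1" if "m \<in> {1, 2}"
    unfolding L1_def
    apply (rule UnI1, rule UnI2, rule CollectI, rule exI, rule exI, rule conjI, rule refl,
        rule conjI, rule that)
    using * three_digit_expansion_cases[OF *(1)] unfolding overflows_def fits_def
    by (elim disjE) simp_all
  show "tpow 1 @ N_run [d, c, b] @ tpow 1 \<in> L1" if "b \<noteq> 0"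
    unfolding L1_def
    apply (rule UnI2, rule CollectI, rule exI, rule conjI, rule refl)
    using that * three_digit_expansion_cases[OF *(1)] unfolding overflows_def fits_def
    by (elim disjE) simp_all
qed

lemma L1_intro:
  assumes "expansion ds" "overflows ds" "length ds \<in> {2, 3}" "0 < k" "k + m < length ds"
    "0 < m \<longrightarrow> hd ds \<noteq> 0"
  shows "tpow (int k) @ N_run (rev ds) @ tpow (int m) \<in> L1"
proof (cases "length ds = 2")
  case True
  then obtain c d where "ds = [c, d]" by (rule length_2_obtain)
  moreover have "k = 1" "m = 0" using assms True by auto
  ultimately show ?thesis using L1_intros(1)[of c d] assms
    by (auto simp del: N_run.simps expansion.simps)
next
  case False
  then obtain b c d where "ds = [b, c, d]"
    using assms length_3_obtain by blast
  moreover from this have "k = 1 \<and> m = 0 \<or> k = 2 \<and> m = 0 \<or> k = 1 \<and> m = 1" using assms by auto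
  moreover from calculation have "expansion [b, c, d]" "overflows [b, c, d]" "0 < m \<longrightarrow> b \<noteq> 0"
    using assms by simp_all
  ultimately show ?thesis using L1_intros(2)[of b c d 1] L1_intros(2)[of b c d 2] L1_intros(3)[of b c d]
    by (elim disjE) (simp_all del: N_run.simps expansion.simps)
qed

lemma L3_intros:
  "expansion [c, d] \<Longrightarrow> P_run [c, d] \<in> L3"
  "expansion [b, c, d] \<Longrightarrow> P_run [b, c, d] \<in> L3"
  "expansion [b, c, d] \<Longrightarrow> b \<noteq> 0 \<Longrightarrow> tpow (- 1) @ P_run [b, c, d] \<in> L3"
proof -
  assume *: "expansion [c, d]"
  show "P_run [c, d] \<in> L3"
    unfolding L3_def L3_printed_def
    apply (rule UnI1, rule UnI1, rule UnI1, rule UnI1, rule CollectI, rule exI, rule conjI, rule refl)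
    using * two_digit_expansion_cases[OF *] by (elim disjE) simp_all
next
  assume *: "expansion [b, c, d]"
  have added: "tpow (- j) @ P_run [b, c, d] \<in> L3" if "b \<noteq> 0" "c = 0" "d = 0" "j \<in> {0, 1}" for j
    unfolding L3_def
    apply (rule UnI2, rule CollectI, rule exI, rule exI, rule conjI, rule refl, rule conjI, rule that)
    using that * by auto
  show "P_run [b, c, d] \<in> L3"
  proof (cases "b \<noteq> 0 \<and> c = 0 \<and> d = 0")
    case True
    then show ?thesis using added[of 0] by simp
  next
    case False
    show ?thesis
      unfolding L3_def L3_printed_def
      apply (rule UnI1, rule UnI1, rule UnI2, rule CollectI, rule exI, rule conjI, rule refl)
      using False * three_digit_expansion_cases[OF *] by (elim disjE) simp_all
  qed
  assume b: "b \<noteq> 0"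
  show "tpow (- 1) @ P_run [b, c, d] \<in> L3"
  proof (cases "c = 0 \<and> d = 0")
    case True
    then show ?thesis using added[of 1] b by simp
  next
    case False
    show ?thesis
      unfolding L3_def L3_printed_def
      apply (rule UnI1, rule UnI2, rule CollectI, rule exI, rule exI, rule conjI, rule refl,
          rule conjI, rule insertI1)
      using False b * three_digit_expansion_cases[OF *] by (elim disjE) simp_all
  qed
qed

lemma L3_intro:
  assumes "expansion ds" "length ds \<in> {2, 3}" "k + 1 < length ds" "0 < k \<longrightarrow> hd ds \<noteq> 0"
  shows "tpow (- int k) @ P_run ds \<in> L3"
proof (cases "length ds = 2")
  case True
  then obtain c d where "ds = [c, d]" by (rule length_2_obtain)
  moreover have "k = 0" using assms True by auto
  ultimately show ?thesis using L3_intros(1)[of c d] assms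
    by (auto simp del: P_run.simps expansion.simps)
next
  case False
  then obtain b c d where "ds = [b, c, d]"
    using assms length_3_obtain by blast
  moreover from this have "k = 0 \<or> k = 1" using assms by auto
  ultimately show ?thesis using L3_intros(2,3)[of b c d] assms
    by (auto simp del: P_run.simps expansion.simps)
qed

text \<open>The third table also lists words such as \<open>t\<^sup>-\<^sup>1a\<^sup>ita\<^sup>j\<close>, whose \<open>t\<close>-exponent is \<open>0\<close> and which do not
  satisfy \<open>k < l\<close>. A positive \<open>t\<close>-exponent excludes them without parsing the word.\<close>

lemma L3_cases:
  assumes "w \<in> L3" "0 < snd (act w (0, 0))"
  shows "\<exists>ds k. w = tpow (- int k) @ P_run ds \<and> expansion ds \<and> k + 1 < length ds \<and>
    (0 < k \<longrightarrow> hd ds \<noteq> 0)"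
proof -
  let ?G = "\<lambda>w. \<exists>ds k. w = tpow (- int k) @ P_run ds \<and> expansion ds \<and> k + 1 < length ds \<and>
    (0 < k \<longrightarrow> hd ds \<noteq> 0)"
  have G: "?G w" if "w = tpow (- j) @ P_run es" "0 \<le> j" "expansion es \<and> (0 < j \<longrightarrow> hd es \<noteq> 0)" for es j
  proof -
    have "es \<noteq> []" using that by auto
    then have "snd (act w (0, 0)) = int (length es - 1) - j"
      using act_tpow_nonpos[of "nat j"] act_P_run[of es] that by simp
    then have "nat j + 1 < length es" using assms(2) that(2) by auto
    then show ?thesis using that by (intro exI[of _ es] exI[of _ "nat j"]) auto
  qed
  have G0: "?G w" if "w = P_run es" "expansion es" for es
    using G[of 0 es] that by auto
  from assms(1) show ?thesis unfolding L3_def L3_printed_def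
    by - (elim UnE CollectE exE conjE; (rule G, assumption | rule G0, assumption);
        elim signs_ConsE insertE emptyE; simp)
qed

lemma L4_intro:
  assumes "expansion [b, c, d]" "overflows [b, c, d]"
  shows "P_run [b, c, d] @ tpow (- 1) \<in> L4"
  unfolding L4_def
  apply (rule CollectI, rule exI, rule conjI, rule refl)
  using assms three_digit_expansion_cases[OF assms(1)] unfolding overflows_def fits_def
  by (elim disjE) simp_all

lemma L4_cases:
  assumes "w \<in> L4"
  shows "\<exists>ds. w = P_run ds @ tpow (- 1) \<and> expansion ds \<and> overflows ds \<and> length ds = 3"
proof -
  have G: "?thesis" if "w = P_run es @ tpow (- 1)" "expansion es \<and> overflows es \<and> length es = 3" for es
    using that by blast
  from assms(1) show ?thesis unfolding L4_def
    by - (elim UnE CollectE exE conjE; (rule G, assumption);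
        elim signs_ConsE insertE emptyE; simp add: overflows_def fits_def)
qed

section \<open>Normal form words described by digits\<close>

text \<open>\<open>N_form\<close> unites the types \<open>N\<close>, \<open>NP\<^sub>\<le>\<close> (for \<open>k = 0\<close>) and \<open>X\<close>, \<open>XN\<close>, \<open>XNP\<close> (for \<open>k > 0\<close>), including
  the powers of \<open>a\<close>, which are the runs with a single digit. \<open>P_form\<close> unites the types \<open>P\<close>, \<open>NP\<^sub>>\<close>
  (for \<open>m = 0\<close>) and \<open>PX\<close>, \<open>NPX\<close> (for \<open>m > 0\<close>).\<close>

definition N_form :: "nat \<Rightarrow> int list \<Rightarrow> nat \<Rightarrow> bool" where
  "N_form k ds m \<longleftrightarrow> expansion ds \<and> k + m < length ds \<and>
     (0 < m \<longrightarrow> hd ds \<noteq> 0) \<and> (0 < k \<longrightarrow> overflows ds)"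

definition P_form :: "nat \<Rightarrow> int list \<Rightarrow> nat \<Rightarrow> bool" where
  "P_form k ds m \<longleftrightarrow> expansion ds \<and> k + m + 1 < length ds \<and>
     (0 < k \<longrightarrow> hd ds \<noteq> 0) \<and> (0 < m \<longrightarrow> overflows ds)"

abbreviation N_word :: "nat \<Rightarrow> int list \<Rightarrow> nat \<Rightarrow> bs_gen word" where
  "N_word k ds m \<equiv> tpow (int k) @ N_run (rev ds) @ tpow (int m)"

abbreviation P_word :: "nat \<Rightarrow> int list \<Rightarrow> nat \<Rightarrow> bs_gen word" where
  "P_word k ds m \<equiv> tpow (- int k) @ P_run ds @ tpow (- int m)"

lemma NF_short_iff: "w \<in> NF_short \<longleftrightarrow> (\<exists>d. w = N_word 0 [d] 0 \<and> N_form 0 [d] 0)"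
  by (auto simp: NF_short_def N_form_def image_iff abs_le_iff)

lemma NF_X_iff: "w \<in> NF_X L1 \<longleftrightarrow> (\<exists>k ds m. w = N_word k ds m \<and> N_form k ds m \<and> 0 < k)"
proof
  assume "w \<in> NF_X L1"
  then obtain k m l es where w: "w = tpow (int k) @ N_run es @ tpow (int m)"
    and len: "length es = Suc l" and km: "0 < k" "k + m \<le> l" "0 < m \<longrightarrow> last es \<noteq> 0"
    and tab: "if 3 \<le> l then long_N prefixes_X es else w \<in> L1"
    unfolding NF_X_def by blast
  show "\<exists>k ds m. w = N_word k ds m \<and> N_form k ds m \<and> 0 < k"
  proof (cases "3 \<le> l")
    case True
    then have "expansion (rev es) \<and> overflows (rev es)"
      using long_run_iff(2)[of "rev es"] tab len by simp
    then have "N_form k (rev es) m" using km len by (simp add: N_form_def hd_rev)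
    then show ?thesis using w km(1) by (metis rev_rev_ident)
  next
    case False
    then show ?thesis using L1_cases[of w] tab unfolding N_form_def by auto
  qed
next
  assume "\<exists>k ds m. w = N_word k ds m \<and> N_form k ds m \<and> 0 < k"
  then obtain k ds m where w: "w = N_word k ds m" and f: "N_form k ds m" and k: "0 < k" by blast
  have "if 3 \<le> length ds - 1 then long_N prefixes_X (rev ds) else w \<in> L1"
  proof (cases "3 \<le> length ds - 1")
    case True
    then show ?thesis using long_run_iff(2)[of ds] f k by (simp add: N_form_def)
  next
    case False
    then have "length ds \<in> {2, 3}" using f k by (auto simp: N_form_def)
    then show ?thesis using L1_intro[of ds k m] f k w False by (simp add: N_form_def)
  qed
  then show "w \<in> NF_X L1" unfolding NF_X_def
    using w f k by (intro CollectI exI[of _ k] exI[of _ m] exI[of _ "length ds - 1"] exI[of _ "rev ds"])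
      (auto simp: N_form_def last_rev)
qed

lemma NF_N_iff:
  "w \<in> NF_short \<or> w \<in> NF_N L2 \<longleftrightarrow> (\<exists>ds m. w = N_word 0 ds m \<and> N_form 0 ds m)"
proof
  assume "w \<in> NF_short \<or> w \<in> NF_N L2"
  then show "\<exists>ds m. w = N_word 0 ds m \<and> N_form 0 ds m"
  proof
    assume "w \<in> NF_N L2"
    then obtain k l es where w: "w = N_run es @ tpow (int k)"
      and len: "length es = Suc l" and k: "k \<le> l" "0 < k \<longrightarrow> last es \<noteq> 0"
      and tab: "if 3 \<le> l then long_N prefixes_N es else w \<in> L2"
      unfolding NF_N_def by blast
    show ?thesis
    proof (cases "3 \<le> l")
      case True
      then have "expansion (rev es)" using long_run_iff(1)[of "rev es"] tab len by simp
      then have "N_form 0 (rev es) k" using k len by (simp add: N_form_def hd_rev)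
      then show ?thesis using w by (intro exI[of _ "rev es"] exI[of _ k]) simp
    next
      case False
      then show ?thesis using L2_cases[of w] tab unfolding N_form_def by auto
    qed
  qed (unfold NF_short_iff, blast)
next
  assume "\<exists>ds m. w = N_word 0 ds m \<and> N_form 0 ds m"
  then obtain ds m where w: "w = N_word 0 ds m" and f: "N_form 0 ds m" by blast
  show "w \<in> NF_short \<or> w \<in> NF_N L2"
  proof (cases "length ds = 1")
    case True
    then obtain d where "ds = [d]" by (auto simp: length_Suc_conv)
    moreover have "m = 0" using f True by (simp add: N_form_def)
    ultimately show ?thesis using w f NF_short_iff by blast
  next
    case ne: False
    have "if 3 \<le> length ds - 1 then long_N prefixes_N (rev ds) else w \<in> L2"
    proof (cases "3 \<le> length ds - 1")
      case True
      then show ?thesis using long_run_iff(1)[of ds] f by (simp add: N_form_def)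
    next
      case False
      then have "length ds = 2 \<or> length ds = 3" using f ne unfolding N_form_def by linarith
      then have "length ds \<in> {2, 3}" by simp
      then show ?thesis using L2_intro[of ds m] f w False by (simp add: N_form_def)
    qed
    then have "w \<in> NF_N L2" unfolding NF_N_def
      using w f by (intro CollectI exI[of _ m] exI[of _ "length ds - 1"] exI[of _ "rev ds"])
        (auto simp: N_form_def last_rev)
    then show ?thesis ..
  qed
qed

lemma act_N_word:
  assumes "N_form k ds m"
  shows "act (N_word k ds m) (0, 0) =
    (of_int (digit_value ds) / 2 ^ (length ds - 1 - k), int m - int (length ds - 1 - k))"
proof -
  define L where "L = length ds - 1 - k"
  have "length ds = Suc (L + k)" using assms unfolding N_form_def L_def by linarith
  moreover have "rev ds \<noteq> []" using assms by (auto simp: N_form_def)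
  ultimately show ?thesis by (simp add: act_N_run power_add)
qed

lemma act_P_word:
  assumes "P_form k ds m"
  shows "act (P_word k ds m) (0, 0) =
    (of_int (digit_value ds) / 2 ^ k, int (length ds - 1) - int k - int m)"
proof -
  have "ds \<noteq> []" using assms by (auto simp: P_form_def)
  then show ?thesis by (simp add: act_P_run)
qed

lemma NF_P_iff: "w \<in> NF_P L3 \<longleftrightarrow> (\<exists>k ds. w = P_word k ds 0 \<and> P_form k ds 0)"
proof
  assume "w \<in> NF_P L3"
  then obtain k l es where w: "w = tpow (- int k) @ P_run es"
    and len: "length es = Suc l" and k: "k < l" "0 < k \<longrightarrow> hd es \<noteq> 0"
    and tab: "if 3 \<le> l then long_P suffixes_P es else w \<in> L3"
    unfolding NF_P_def by blast
  show "\<exists>k ds. w = P_word k ds 0 \<and> P_form k ds 0"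
  proof (cases "3 \<le> l")
    case True
    then have "expansion es" using long_run_iff(3)[of es] tab len by simp
    then have "P_form k es 0" using k len by (simp add: P_form_def)
    then show ?thesis using w by (intro exI[of _ k] exI[of _ es]) simp
  next
    case False
    have "es \<noteq> []" using len by auto
    then have "0 < snd (act w (0, 0))" using len k by (simp add: w act_P_run)
    then show ?thesis using L3_cases[of w] tab False unfolding P_form_def by auto
  qed
next
  assume "\<exists>k ds. w = P_word k ds 0 \<and> P_form k ds 0"
  then obtain k ds where w: "w = P_word k ds 0" and f: "P_form k ds 0" by blast
  have "if 3 \<le> length ds - 1 then long_P suffixes_P ds else w \<in> L3"
  proof (cases "3 \<le> length ds - 1")
    case True
    then show ?thesis using long_run_iff(3)[of ds] f by (simp add: P_form_def)
  next
    case False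
    then have "length ds \<in> {2, 3}" using f by (auto simp: P_form_def)
    then show ?thesis using L3_intro[of ds k] f w False by (simp add: P_form_def)
  qed
  then show "w \<in> NF_P L3" unfolding NF_P_def
    using w f by (intro CollectI exI[of _ k] exI[of _ "length ds - 1"] exI[of _ ds])
      (auto simp: P_form_def)
qed

lemma NF_PX_iff: "w \<in> NF_PX L4 \<longleftrightarrow> (\<exists>k ds m. w = P_word k ds m \<and> P_form k ds m \<and> 0 < m)"
proof
  assume "w \<in> NF_PX L4"
  then obtain k m l es where w: "w = tpow (- int k) @ P_run es @ tpow (- int m)"
    and len: "length es = Suc l" and km: "0 < m" "k + m < l" "0 < k \<longrightarrow> hd es \<noteq> 0"
    and tab: "if 3 \<le> l then long_P suffixes_PX es else w \<in> L4"
    unfolding NF_PX_def by blast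
  show "\<exists>k ds m. w = P_word k ds m \<and> P_form k ds m \<and> 0 < m"
  proof (cases "3 \<le> l")
    case True
    then have "expansion es \<and> overflows es" using long_run_iff(4)[of es] tab len by simp
    then have "P_form k es m" using km len by (simp add: P_form_def)
    then show ?thesis using w km(1) by blast
  next
    case False
    then obtain ds where "w = P_run ds @ tpow (- 1)" "expansion ds" "overflows ds" "length ds = 3"
      using L4_cases[of w] tab by auto
    then have "w = P_word 0 ds 1 \<and> P_form 0 ds 1" by (simp add: P_form_def)
    then show ?thesis by (metis zero_less_one)
  qed
next
  assume "\<exists>k ds m. w = P_word k ds m \<and> P_form k ds m \<and> 0 < m"
  then obtain k ds m where w: "w = P_word k ds m" and f: "P_form k ds m" and m: "0 < m" by blast
  have "if 3 \<le> length ds - 1 then long_P suffixes_PX ds else w \<in> L4"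
  proof (cases "3 \<le> length ds - 1")
    case True
    then show ?thesis using long_run_iff(4)[of ds] f m by (simp add: P_form_def)
  next
    case False
    then have "length ds = 3" "k = 0" "m = 1" using f m by (auto simp: P_form_def)
    moreover from this obtain b c d where "ds = [b, c, d]" using length_3_obtain by blast
    ultimately show ?thesis using L4_intro[of b c d] f w
      by (simp add: P_form_def del: P_run.simps expansion.simps)
  qed
  then show "w \<in> NF_PX L4" unfolding NF_PX_def
    using w f m by (intro CollectI exI[of _ k] exI[of _ m] exI[of _ "length ds - 1"] exI[of _ ds])
      (auto simp: P_form_def)
qed

lemma NF_iff:
  "w \<in> NF \<longleftrightarrow> (\<exists>k ds m. w = N_word k ds m \<and> N_form k ds m) \<or>
     (\<exists>k ds m. w = P_word k ds m \<and> P_form k ds m)"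
proof -
  have "w \<in> NF \<longleftrightarrow> (w \<in> NF_short \<or> w \<in> NF_N L2) \<or> w \<in> NF_X L1 \<or> w \<in> NF_P L3 \<or> w \<in> NF_PX L4"
    unfolding NF_def by blast
  then show ?thesis
    unfolding NF_N_iff NF_X_iff NF_P_iff NF_PX_iff by (metis not_gr_zero)
qed

section \<open>Existence and uniqueness\<close>

text \<open>The conditions \<open>\<epsilon>\<^sub>0 \<noteq> 0\<close> thus mean that the coordinate \<open>x\<close> is given in lowest terms. In both cases
  the run has at least two digits, so that the lowest one is in \<open>{0, 1, -1}\<close> and nonzero means odd.\<close>

lemma odd_digit_value_form:
  "N_form k ds m \<Longrightarrow> 0 < m \<Longrightarrow> odd (digit_value ds)"
  "P_form k ds m \<Longrightarrow> 0 < k \<Longrightarrow> odd (digit_value ds)"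
  using even_digit_value[of ds] by (auto simp: N_form_def P_form_def)

lemma NF_exists:
  fixes J :: int
  assumes "x = of_int J / 2 ^ p"
  shows "\<exists>w \<in> NF. act w (0, 0) = (x, n)"
proof (cases "n \<le> 0")
  case True
  obtain m M where M: "x = of_int M / 2 ^ (nat (- n) + m)" "0 < m \<longrightarrow> odd M"
    using dyadic_lowest_terms_exists[OF assms, of "nat (- n)"] by blast
  obtain k ds where ds: "length ds = Suc (nat (- n) + m + k)" "expansion ds"
      "0 < k \<longrightarrow> overflows ds" "digit_value ds = M"
    using expansion_with_surplus_exists[of "nat (- n) + m" M] by blast
  have f: "N_form k ds m"
    using ds M(2) even_digit_value_if_hd_0[of ds] by (auto simp: N_form_def)
  then have "act (N_word k ds m) (0, 0) = (x, n)"
    unfolding act_N_word[OF f] using ds M(1) True by simp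
  then show ?thesis using f NF_iff by blast
next
  case False
  obtain k M where M: "x = of_int M / 2 ^ k" "0 < k \<longrightarrow> odd M"
    using dyadic_lowest_terms_exists[OF assms, of 0] by auto
  obtain m ds where ds: "length ds = Suc (nat n + k + m)" "expansion ds"
      "0 < m \<longrightarrow> overflows ds" "digit_value ds = M"
    using expansion_with_surplus_exists[of "nat n + k" M] by blast
  have f: "P_form k ds m"
    using ds M(2) even_digit_value_if_hd_0[of ds] False by (auto simp: P_form_def)
  then have "act (P_word k ds m) (0, 0) = (x, n)"
    unfolding act_P_word[OF f] using ds M(1) False by simp
  then show ?thesis using f NF_iff by blast
qed

lemma N_word_unique:
  assumes f: "N_form k ds m" "N_form k' ds' m'"
    and eq: "act (N_word k ds m) (0, 0) = act (N_word k' ds' m') (0, 0)"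
  shows "N_word k ds m = N_word k' ds' m'"
proof -
  \<comment> \<open>The number \<open>c\<close> is minus the \<open>t\<close>-exponent, hence the same for both words.\<close>
  define c where "c = length ds - 1 - k - m"
  have len: "length ds = Suc (c + m + k)" using f(1) unfolding c_def N_form_def by linarith
  have "int m - int (length ds - 1 - k) = int m' - int (length ds' - 1 - k')"
    using eq f by (simp only: act_N_word prod.inject)
  then have len': "length ds' = Suc (c + m' + k')" using f(2) len by (simp add: N_form_def)
  have "(of_int (digit_value ds) :: real) / 2 ^ (c + m) = of_int (digit_value ds') / 2 ^ (c + m')"
    using eq f len len' by (simp only: act_N_word prod.inject) simp
  then have "m = m' \<and> digit_value ds = digit_value ds'"
    using odd_digit_value_form(1) f by (intro dyadic_lowest_terms_unique) auto
  moreover from this have "k = k' \<and> ds = ds'"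
    using f len len' by (intro expansion_with_surplus_unique[of ds "c + m" k]) (auto simp: N_form_def)
  ultimately show ?thesis by simp
qed

lemma P_word_unique:
  assumes f: "P_form k ds m" "P_form k' ds' m'"
    and eq: "act (P_word k ds m) (0, 0) = act (P_word k' ds' m') (0, 0)"
  shows "P_word k ds m = P_word k' ds' m'"
proof -
  have e: "(of_int (digit_value ds) :: real) / 2 ^ k = of_int (digit_value ds') / 2 ^ k'"
    "int (length ds - 1) - int k - int m = int (length ds' - 1) - int k' - int m'"
    using eq f by (simp_all only: act_P_word prod.inject)
  have "k = k' \<and> digit_value ds = digit_value ds'"
    using e(1) odd_digit_value_form(2) f by (intro dyadic_lowest_terms_unique[where c = 0]) auto
  moreover from this have "m = m' \<and> ds = ds'"
    using f e(2) by (intro expansion_with_surplus_unique[of ds "length ds - 1 - m" m])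
      (auto simp: P_form_def)
  ultimately show ?thesis by simp
qed

text \<open>The sign of the \<open>t\<close>-exponent separates the two forms.\<close>

lemma NF_unique:
  assumes "w \<in> NF" "w' \<in> NF" and eq: "act w (0, 0) = act w' (0, 0)"
  shows "w = w'"
proof -
  have N: "snd (act (N_word k ds m) (0, 0)) \<le> 0" if "N_form k ds m" for k ds m
    unfolding act_N_word[OF that] using that by (simp add: N_form_def)
  have P: "0 < snd (act (P_word k ds m) (0, 0))" if "P_form k ds m" for k ds m
    unfolding act_P_word[OF that] using that by (simp add: P_form_def)
  from assms(1,2)[unfolded NF_iff] show ?thesis
    using N_word_unique P_word_unique eq by (elim disjE exE conjE) (metis N P not_less)+
qed

theorem lemma21:
  shows "\<forall>g \<in> carrier BS12. \<exists>!w. w \<in> NF \<and> represents w g"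
proof
  fix g assume "g \<in> carrier BS12"
  then obtain u where g: "g = elt u"
    by (auto simp: BS12_def carrier_presented_group)
  obtain p j q where "elt u = elt (tat p j q)"
    using elt_eq_tat by blast
  from act_elt[OF this, of "(0, 0)"]
  have u: "act u (0, 0) = (of_int j / 2 ^ p, q - int p)" by (simp only: act_tat)
  obtain w where w: "w \<in> NF" "act w (0, 0) = act u (0, 0)"
    using NF_exists[OF refl] u by metis
  show "\<exists>!w. w \<in> NF \<and> represents w g"
  proof
    show "w \<in> NF \<and> represents w g"
      using w(1) act_faithful[OF w(2)] by (simp only: represents_def g)
    fix w' assume "w' \<in> NF \<and> represents w' g"
    then have "w' \<in> NF" "act w' (0, 0) = act u (0, 0)"
      using act_elt[of w' u] by (simp_all only: represents_def g)
    then show "w' = w"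
      using w NF_unique[of w' w] by (simp only:)
  qed
qed

end
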